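(* With the data and operators $S$, $\Psi$, $\mathcal C$, $\mathcal D$ described in the context, the bilevel (inverse optimal control) problem $$\min_{\beta,u}\left\{\frac12\sum_{r=1}^p\Bigl(\|\mathcal C(S(u)-z_{\mathrm o,r})\|_{H_z}^2+\|\mathcal D(u-u_{\mathrm o,r})\|_{H_u}^2\Bigr)\ \middle|\ \beta\in(\Lambda^m)^{|V_D|},\ u=\Psi(\beta)\right\}$$ possesses a globally optimal solution.
   Context: Network. $\mathcal T=(0,T)$, $\Omega=(0,\omega)$ with $T,\omega>0$. $G=(V,E)$ is a directed graph which is a tree (the underlying undirected graph is connected and has no cycles), $V=\{v_0,\dots,v_n\}$, $|E|=n$. The unique source vertex is $v_0$ (the only vertex without incoming edge); exactly one edge leaves $v_0$, and it ends at $v_1$. Every $v_i$ with $i\ge1$ is the end of exactly one edge, denoted by $(i)$. $V_D\subset V$ is the set of vertices with no outgoing edges (demand vertices), $V_I:=V\setminus(V_D\cup\{v_0\})$, $E_D:=\{(i)\in E\mid v_i\in V_D\}$ (so $|E_D|=|V_D|$), and $E^+(i)$ is the set of edges starting at $v_i$. For each $i\in\{1,\dots,n\}$, $\lambda^{(i)}>0$ is a constant; for $v_i\in V_I$, $(k)\in E^+(i)$, $\alpha_{i,k}>0$ is a constant, with $\sum_{(k)\in E^+(i)}\alpha_{i,k}=1$. Solution operator $S$. $C(\overline\Omega,L^2(\mathcal T,\mathbb R^n))$ is the space of $z:\mathcal T\times\overline\Omega\to\mathbb R^n$ with $z(\cdot,x)\in L^2(\mathcal T,\mathbb R^n)$ for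 each $x\in\overline\Omega$ and $x\mapsto z(\cdot,x)$ continuous into $L^2(\mathcal T,\mathbb R^n)$, normed by $\max_{x\in\overline\Omega}\|z(\cdot,x)\|_{L^2(\mathcal T,\mathbb R^n)}$. $S:L^2(\mathcal T)\to C(\overline\Omega,L^2(\mathcal T,\mathbb R^n))$ assigns to $u$ the unique weak solution $z=(z^{(1)},\dots,z^{(n)})$ of the linear network conservation law $z^{(i)}_t+\lambda^{(i)}z^{(i)}_x=0$, $z^{(i)}(0,\cdot)=0$ ($(i)\in E$), $\lambda^{(1)}z^{(1)}(\cdot,0)=u$, $\lambda^{(k)}z^{(k)}(\cdot,0)=\alpha_{i,k}\lambda^{(i)}z^{(i)}(\cdot,\omega)$ ($v_i\in V_I$, $(k)\in E^+(i)$). Explicitly, for all $x\in\overline\Omega$ and a.e. $t\in\mathcal T$: $z^{(1)}(t,x)=\frac1{\lambda^{(1)}}u(t-x/\lambda^{(1)})$ if $t-x/\lambda^{(1)}>0$ and $z^{(1)}(t,x)=0$ otherwise; and for $v_i\in V_I$, $(k)\in E^+(i)$: $z^{(k)}(t,x)=\alpha_{i,k}\frac{\lambda^{(i)}}{\lambda^{(k)}}z^{(i)}(t-x/\lambda^{(k)},\omega)$ if $t-x/\lambda^{(k)}>0$ and $z^{(k)}(t,x)=0$ otherwise. $S^{(i)}(u)$ is the $i$-th component of $S(u)$ and $S^{(i)}_\omega(u):=S^{(i)}(u)(\cdot,\omega)\in L^2(\mathcal T)$. The operators $S$, $S^{(i)}$, $S^{(i)}_\omega$ are linear and continuous. Lower-level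 problem and $\Psi$. $m\in\mathbb N$, $m\ge2$; $D^{(i)}_1,\dots,D^{(i)}_m\in L^2(\mathcal T)$ for each $(i)\in E_D$ are given; $\sigma>0$ is given; $\beta=(\beta^{(i)})_{(i)\in E_D}\in(\mathbb R^m)^{|V_D|}$; $$f(u,\beta):=\frac12\sum_{(i)\in E_D}\Bigl\|S^{(i)}_\omega(u)-\sum_{\ell=1}^m\beta^{(i)}_\ell D^{(i)}_\ell\Bigr\|^2_{L^2(\mathcal T)}+\frac\sigma2\|u\|^2_{L^2(\mathcal T)}.$$ $U_{\mathrm{ad}}:=\{u\in L^2(\mathcal T)\mid u_{\mathrm a}(t)\le u(t)\le u_{\mathrm b}(t)\text{ a.e. on }\mathcal T\}$ for given measurable functions $u_{\mathrm a}:\mathcal T\to\{-\infty\}\cup\mathbb R$ and $u_{\mathrm b}:\mathcal T\to\mathbb R\cup\{\infty\}$, and $U_{\mathrm{ad}}$ is assumed to be nonempty. For each $\beta$ the problem $\min_u\{f(u,\beta)\mid u\in U_{\mathrm{ad}}\}$ has exactly one global minimizer, and $\Psi:(\mathbb R^m)^{|V_D|}\to L^2(\mathcal T)$ assigns this minimizer to $\beta$. Upper-level data. $\Lambda^m:=\{b\in\mathbb R^m\mid b\ge0,\ \sum_{\ell=1}^m b_\ell=1\}$ is the standard simplex. $p\in\mathbb N$, and $(z_{\mathrm o,r},u_{\mathrm o,r})\in C(\overline\Omega,L^2(\mathcal T,\mathbb R^n))\times L^2(\mathcal T)$, $r=1,\dots,p$, are given observations. $H_z$ and $H_u$ are Hilbert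 spaces, and $\mathcal C:C(\overline\Omega,L^2(\mathcal T,\mathbb R^n))\to H_z$ and $\mathcal D:L^2(\mathcal T)\to H_u$ are linear, continuous mappings (observation operators). *)

theory Defs
  imports "HOL-Analysis.Analysis" "Graph_Theory.Digraph_Component"
begin

section \<open>The network\<close>

text \<open>Vertex \<open>v_i\<close> is the natural number \<open>i\<close>. Since every \<open>v_i\<close> with \<open>1 \<le> i\<close> is the end of exactly
  one edge, that edge \<open>(i)\<close> is addressed by the number \<open>i\<close> as well.\<close>

record network =
  horizon :: real                        \<comment> \<open>\<open>T\<close>\<close>
  edge_len :: real                       \<comment> \<open>\<open>\<omega>\<close>\<close>
  num_edges :: nat                       \<comment> \<open>\<open>n\<close>\<close>
  net_graph :: "nat pair_pre_digraph"    \<comment> \<open>\<open>G\<close>\<close>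
  velocity :: "nat \<Rightarrow> real"              \<comment> \<open>\<open>\<lambda>\<close>\<close>
  ratio :: "nat \<Rightarrow> nat \<Rightarrow> real"          \<comment> \<open>\<open>\<alpha>\<close>, indexed by the vertex and by the edge leaving it\<close>

definition demand_vertices :: "network \<Rightarrow> nat set" where
  "demand_vertices N = {v \<in> pverts (net_graph N). out_arcs (net_graph N) v = {}}"

definition inner_vertices :: "network \<Rightarrow> nat set" where
  "inner_vertices N = pverts (net_graph N) - (demand_vertices N \<union> {0})"

text \<open>The library predicate \<open>tree\<close> only excludes directed cycles, but here the underlying
  undirected graph has to be free of cycles. In the symmetric closure every edge yields a closed
  walk of length 2; so the cycles of the undirected graph are those of length at least 3.\<close>

definition undirected_tree :: "'a pair_pre_digraph \<Rightarrow> bool" where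
  "undirected_tree G \<longleftrightarrow> Digraph_Component.connected (with_proj G) \<and>
     \<not> (\<exists>p. pre_digraph.cycle (with_proj (mk_symmetric (with_proj G))) p \<and> 3 \<le> length p)"

definition is_network :: "network \<Rightarrow> bool" where
  "is_network N \<longleftrightarrow>
     0 < horizon N \<and> 0 < edge_len N \<and>
     pverts (net_graph N) = {0..num_edges N} \<and>
     pair_wf_digraph (net_graph N) \<and>
     card (parcs (net_graph N)) = num_edges N \<and>
     undirected_tree (net_graph N) \<and>
     (\<forall>v\<in>pverts (net_graph N). in_arcs (net_graph N) v = {} \<longleftrightarrow> v = 0) \<and>
     out_arcs (net_graph N) 0 = {(0, 1)} \<and>
     (\<forall>i\<in>{1..num_edges N}. card (in_arcs (net_graph N) i) = 1) \<and>
     (\<forall>i\<in>{1..num_edges N}. 0 < velocity N i) \<and>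
     (\<forall>i\<in>inner_vertices N.
        (\<forall>k. (i, k) \<in> parcs (net_graph N) \<longrightarrow> 0 < ratio N i k) \<and>
        (\<Sum>k | (i, k) \<in> parcs (net_graph N). ratio N i k) = 1)"

section \<open>Function spaces\<close>

text \<open>Elements of \<open>L\<^sup>2(0,T)\<close> are given by representatives; equality in \<open>L\<^sup>2(0,T)\<close> is equality almost
  everywhere on \<open>(0,T)\<close>, and values outside \<open>(0,T)\<close> are irrelevant.\<close>

definition L2 :: "real \<Rightarrow> (real \<Rightarrow> real) set" where
  "L2 T = {u. u \<in> borel_measurable (lebesgue_on {0<..<T}) \<and>
              integrable (lebesgue_on {0<..<T}) (\<lambda>t. (u t)\<^sup>2)}"

definition L2_norm :: "real \<Rightarrow> (real \<Rightarrow> real) \<Rightarrow> real" where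
  "L2_norm T u = sqrt (\<integral>t. (u t)\<^sup>2 \<partial>lebesgue_on {0<..<T})"

text \<open>A function \<open>z\<close> from \<open>(0,T) \<times> [0,\<omega>]\<close> to \<open>\<real>\<^sup>n\<close> is represented by the real function mapping \<open>(i, t, x)\<close>
  to the component \<open>z\<^sup>i(t, x)\<close>, where \<open>1 \<le> i \<le> n\<close>.\<close>

type_synonym state = "nat \<times> real \<times> real \<Rightarrow> real"

definition slice_norm :: "network \<Rightarrow> state \<Rightarrow> real \<Rightarrow> real" where
  "slice_norm N z x = sqrt (\<Sum>i=1..num_edges N. (L2_norm (horizon N) (\<lambda>t. z (i, t, x)))\<^sup>2)"

definition state_space :: "network \<Rightarrow> state set" where
  "state_space N = {z.
     (\<forall>x\<in>{0..edge_len N}. \<forall>i\<in>{1..num_edges N}. (\<lambda>t. z (i, t, x)) \<in> L2 (horizon N)) \<and>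
     (\<forall>x\<in>{0..edge_len N}.
        ((\<lambda>y. slice_norm N (\<lambda>(i, t, _). z (i, t, y) - z (i, t, x)) x) \<longlongrightarrow> 0)
          (at x within {0..edge_len N}))}"

definition state_norm :: "network \<Rightarrow> state \<Rightarrow> real" where
  "state_norm N z = (SUP x\<in>{0..edge_len N}. slice_norm N z x)"

text \<open>Linear and continuous maps on a space \<open>X\<close> of representatives with seminorm \<open>\<nu>\<close>. By linearity
  and boundedness, representatives of the same element have the same image, so these are exactly
  the linear and continuous maps on the associated normed space.\<close>

definition bounded_linear_map ::
  "('a \<Rightarrow> real) set \<Rightarrow> (('a \<Rightarrow> real) \<Rightarrow> real) \<Rightarrow> (('a \<Rightarrow> real) \<Rightarrow> 'h::real_normed_vector) \<Rightarrow> bool" where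
  "bounded_linear_map X \<nu> F \<longleftrightarrow>
     (\<forall>f\<in>X. \<forall>g\<in>X. F (\<lambda>s. f s + g s) = F f + F g) \<and>
     (\<forall>c. \<forall>f\<in>X. F (\<lambda>s. c * f s) = c *\<^sub>R F f) \<and>
     (\<exists>K. \<forall>f\<in>X. norm (F f) \<le> K * \<nu> f)"

section \<open>Solution operator\<close>

text \<open>The explicit formula, along characteristics, for the weak solution of
  \<open>z\<^sup>i\<^sub>t + \<lambda>\<^sub>i z\<^sup>i\<^sub>x = 0\<close>, \<open>z\<^sup>i(0, \<cdot>) = 0\<close>, \<open>\<lambda>\<^sub>1 z\<^sup>1(\<cdot>, 0) = u\<close>,
  \<open>\<lambda>\<^sub>k z\<^sup>k(\<cdot>, 0) = \<alpha>\<^sub>i\<^sub>k \<lambda>\<^sub>i z\<^sup>i(\<cdot>, \<omega>)\<close> for the inner vertices \<open>v_i\<close> and the edges \<open>(k)\<close> leaving them.\<close>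

definition solves_network :: "network \<Rightarrow> (real \<Rightarrow> real) \<Rightarrow> state \<Rightarrow> bool" where
  "solves_network N u z \<longleftrightarrow>
     (\<forall>x\<in>{0..edge_len N}.
        (AE t in lebesgue_on {0<..<horizon N}.
           z (1, t, x) =
             (if t - x / velocity N 1 > 0
              then 1 / velocity N 1 * u (t - x / velocity N 1) else 0)) \<and>
        (\<forall>i\<in>inner_vertices N. \<forall>k. (i, k) \<in> parcs (net_graph N) \<longrightarrow>
           (AE t in lebesgue_on {0<..<horizon N}.
              z (k, t, x) =
                (if t - x / velocity N k > 0
                 then ratio N i k * (velocity N i / velocity N k) *
                        z (i, t - x / velocity N k, edge_len N) else 0))))"

text \<open>A representative of the solution, which is unique up to null sets.\<close>

definition sol_op :: "network \<Rightarrow> (real \<Rightarrow> real) \<Rightarrow> state" where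
  "sol_op N u = (SOME z. z \<in> state_space N \<and> solves_network N u z)"

definition outflow :: "network \<Rightarrow> nat \<Rightarrow> (real \<Rightarrow> real) \<Rightarrow> real \<Rightarrow> real" where
  "outflow N i u = (\<lambda>t. sol_op N u (i, t, edge_len N))"

section \<open>Lower-level problem\<close>

text \<open>The weight vector of a demand vertex has type \<open>real ^ 'm\<close>; a weight family \<open>\<beta>\<close> is indexed by
  the demand vertices.\<close>

definition lower_objective ::
  "network \<Rightarrow> (nat \<Rightarrow> 'm::finite \<Rightarrow> real \<Rightarrow> real) \<Rightarrow> real \<Rightarrow> (real \<Rightarrow> real) \<Rightarrow> (nat \<Rightarrow> real ^ 'm) \<Rightarrow> real" where
  "lower_objective N D \<sigma> u \<beta> =
     1 / 2 * (\<Sum>i\<in>demand_vertices N.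
        (L2_norm (horizon N) (\<lambda>t. outflow N i u t - (\<Sum>l\<in>UNIV. \<beta> i $ l * D i l t)))\<^sup>2) +
     \<sigma> / 2 * (L2_norm (horizon N) u)\<^sup>2"

definition admissible :: "real \<Rightarrow> (real \<Rightarrow> ereal) \<Rightarrow> (real \<Rightarrow> ereal) \<Rightarrow> (real \<Rightarrow> real) set" where
  "admissible T ua ub =
     {u \<in> L2 T. AE t in lebesgue_on {0<..<T}. ua t \<le> ereal (u t) \<and> ereal (u t) \<le> ub t}"

text \<open>A representative of the global minimizer, which is unique up to null sets.\<close>

definition Psi ::
  "network \<Rightarrow> (nat \<Rightarrow> 'm::finite \<Rightarrow> real \<Rightarrow> real) \<Rightarrow> real \<Rightarrow> (real \<Rightarrow> ereal) \<Rightarrow> (real \<Rightarrow> ereal) \<Rightarrow>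
   (nat \<Rightarrow> real ^ 'm) \<Rightarrow> real \<Rightarrow> real" where
  "Psi N D \<sigma> ua ub \<beta> =
     arg_min (\<lambda>u. lower_objective N D \<sigma> u \<beta>) (\<lambda>u. u \<in> admissible (horizon N) ua ub)"

section \<open>Upper-level problem\<close>

definition std_simplex :: "(real ^ 'm::finite) set" where
  "std_simplex = {b. (\<forall>l. 0 \<le> b $ l) \<and> (\<Sum>l\<in>UNIV. b $ l) = 1}"

definition bilevel_feasible ::
  "network \<Rightarrow> (nat \<Rightarrow> 'm::finite \<Rightarrow> real \<Rightarrow> real) \<Rightarrow> real \<Rightarrow> (real \<Rightarrow> ereal) \<Rightarrow> (real \<Rightarrow> ereal) \<Rightarrow>
   ((nat \<Rightarrow> real ^ 'm) \<times> (real \<Rightarrow> real)) set" where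
  "bilevel_feasible N D \<sigma> ua ub =
     {(\<beta>, u). \<beta> \<in> demand_vertices N \<rightarrow>\<^sub>E std_simplex \<and> u \<in> L2 (horizon N) \<and>
        (AE t in lebesgue_on {0<..<horizon N}. u t = Psi N D \<sigma> ua ub \<beta> t)}"

definition bilevel_objective ::
  "network \<Rightarrow> nat \<Rightarrow> (nat \<Rightarrow> state) \<Rightarrow> (nat \<Rightarrow> real \<Rightarrow> real) \<Rightarrow> (state \<Rightarrow> 'hz::real_normed_vector) \<Rightarrow>
   ((real \<Rightarrow> real) \<Rightarrow> 'hu::real_normed_vector) \<Rightarrow> (real \<Rightarrow> real) \<Rightarrow> real" where
  "bilevel_objective N p zo uo Cobs Dobs u =
     1 / 2 * (\<Sum>r=1..p.
        (norm (Cobs (\<lambda>s. sol_op N u s - zo r s)))\<^sup>2 + (norm (Dobs (\<lambda>t. u t - uo r t)))\<^sup>2)"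

end

theory Submission
  imports Defs
begin

text \<open>Following the characteristics from the source, the solution on edge \<open>k\<close> is the delayed and
  scaled inflow \<open>z\<^sup>k(t, x) = c\<^sub>k u(t - d\<^sub>k - x / \<lambda>\<^sub>k)\<close>, so \<open>S\<close> is linear and bounded, and it takes values in
  the state space because translations are continuous in \<open>L\<^sup>2\<close>. The Tikhonov term makes the lower-level
  objective uniformly convex: minimizers exist, grow quadratically away from their minimum, and
  comparing this growth at two minimizers shows that \<open>\<Psi>\<close> is Lipschitz continuous. Hence the upper-level
  objective is a continuous function of \<open>\<beta>\<close> on a compact product of simplices.\<close>

section \<open>Square integrable functions\<close>

text \<open>\<open>sol_op\<close> and \<open>Psi\<close> are choices of representatives, so
  linearity need not hold pointwise for \<open>sol_op\<close>. Facts about S are therefore routed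
  through an explicit, truly linear formula that agrees with the chosen solution almost everywhere
  at each fixed position, and the later estimates are phrased by seminorms of differences. Convexity
  makes minimizing sequences converge strongly, so no weak compactness enters. The pointwise control
  bounds, possibly infinite, pass to the limit along an almost everywhere convergent subsequence,
  which is why completeness also delivers one. Stability of \<open>Psi\<close> needs no derivative:
  test each of two minimizers in the problem of the other and add the growth inequalities. The
  regularization and all pure squares cancel, leaving inner products of outflow differences with
  target differences. The first factor is at most \<open>gain\<close> times the distance of the
  controls; dividing by that distance gives the Lipschitz constant
  \<open>2 * gain / \<sigma>\<close>.\<close>

lemma L2_measurable: "u \<in> L2 T \<Longrightarrow> u \<in> borel_measurable (lebesgue_on {0<..<T})"
  and L2_square_integrable: "u \<in> L2 T \<Longrightarrow> integrable (lebesgue_on {0<..<T}) (\<lambda>t. (u t)\<^sup>2)"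
  by (auto simp: L2_def)

lemma L2_norm_nonneg [simp]: "0 \<le> L2_norm T u"
  and L2_norm_squared: "(L2_norm T u)\<^sup>2 = (\<integral>t. (u t)\<^sup>2 \<partial>lebesgue_on {0<..<T})"
  by (simp_all add: L2_norm_def)

section \<open>Algebra of the inner product and the seminorm on L2\<close>

lemma L2_mult_integrable:
  assumes "u \<in> L2 T" "v \<in> L2 T"
  shows "integrable (lebesgue_on {0<..<T}) (\<lambda>t. u t * v t)"
proof (rule Bochner_Integration.integrable_bound)
  show "integrable (lebesgue_on {0<..<T}) (\<lambda>t. (u t)\<^sup>2 + (v t)\<^sup>2)"
    using assms by (intro Bochner_Integration.integrable_add L2_square_integrable)
  show "(\<lambda>t. u t * v t) \<in> borel_measurable (lebesgue_on {0<..<T})"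
    using assms[THEN L2_measurable] by simp
  have "\<bar>a * b\<bar> \<le> a\<^sup>2 + b\<^sup>2" for a b :: real
  proof -
    have "0 \<le> \<bar>a * b\<bar>" by simp
    then show ?thesis
      using sum_squares_bound[of "\<bar>a\<bar>" "\<bar>b\<bar>"] unfolding abs_mult power2_abs by linarith
  qed
  then show "AE t in lebesgue_on {0<..<T}. norm (u t * v t) \<le> norm ((u t)\<^sup>2 + (v t)\<^sup>2)"
    by simp
qed

lemma lincomb_squared:
  "(a * x + b * y)\<^sup>2 = a\<^sup>2 * x\<^sup>2 + 2 * a * b * (x * y) + b\<^sup>2 * y\<^sup>2" for a b x y :: real
  by (simp add: power2_eq_square algebra_simps)

lemma L2_lincomb:
  assumes "u \<in> L2 T" "v \<in> L2 T"
  shows "(\<lambda>t. a * u t + b * v t) \<in> L2 T"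
  using assms L2_mult_integrable[OF assms]
  by (auto simp: L2_def lincomb_squared)

text \<open>Polarization with free coefficients: special choices yield Cauchy-Schwarz, the triangle
  inequality and the midpoint identity.\<close>

lemma L2_norm_squared_lincomb:
  assumes "u \<in> L2 T" "v \<in> L2 T"
  shows "(L2_norm T (\<lambda>t. a * u t + b * v t))\<^sup>2 = a\<^sup>2 * (L2_norm T u)\<^sup>2 +
    2 * a * b * (\<integral>t. u t * v t \<partial>lebesgue_on {0<..<T}) + b\<^sup>2 * (L2_norm T v)\<^sup>2"
  using assms[THEN L2_square_integrable] L2_mult_integrable[OF assms]
  by (simp add: L2_norm_squared lincomb_squared)

lemma L2_add: "u \<in> L2 T \<Longrightarrow> v \<in> L2 T \<Longrightarrow> (\<lambda>t. u t + v t) \<in> L2 T"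
  using L2_lincomb[of u T v 1 1] by simp

lemma L2_diff: "u \<in> L2 T \<Longrightarrow> v \<in> L2 T \<Longrightarrow> (\<lambda>t. u t - v t) \<in> L2 T"
  using L2_lincomb[of u T v 1 "-1"] by simp

lemma L2_cmult: "u \<in> L2 T \<Longrightarrow> (\<lambda>t. a * u t) \<in> L2 T"
  using L2_lincomb[of u T u a 0] by simp

lemma L2_const: "(\<lambda>_. c) \<in> L2 T"
  by (simp add: L2_def finite_measure.integrable_const finite_measure_lebesgue_on lmeasurable_interval)

lemma L2_sum: "(\<And>i. i \<in> I \<Longrightarrow> u i \<in> L2 T) \<Longrightarrow> (\<lambda>t. \<Sum>i\<in>I. u i t) \<in> L2 T"
  by (induction I rule: infinite_finite_induct) (auto intro: L2_add L2_const)

lemma L2_norm_cmult: "L2_norm T (\<lambda>t. a * u t) = \<bar>a\<bar> * L2_norm T u"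
  by (simp add: L2_norm_def power_mult_distrib real_sqrt_mult)

text \<open>Discriminant argument: the squared norm of \<open>a * u + b * v\<close> is a nonnegative
  quadratic form in \<open>a\<close> and \<open>b\<close>.\<close>

lemma L2_Cauchy_Schwarz:
  assumes "u \<in> L2 T" "v \<in> L2 T"
  shows "\<bar>\<integral>t. u t * v t \<partial>lebesgue_on {0<..<T}\<bar> \<le> L2_norm T u * L2_norm T v"
proof -
  let ?I = "\<integral>t. u t * v t \<partial>lebesgue_on {0<..<T}"
  let ?a = "(L2_norm T u)\<^sup>2" and ?b = "(L2_norm T v)\<^sup>2"
  have *: "0 \<le> a\<^sup>2 * ?a + 2 * a * b * ?I + b\<^sup>2 * ?b" for a b
    unfolding L2_norm_squared_lincomb[OF assms, symmetric] by simp
  have "?I\<^sup>2 \<le> ?a * ?b"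
  proof (cases "?b = 0")
    case True
    have "?I = 0"
    proof (rule ccontr)
      assume "?I \<noteq> 0"
      \<comment> \<open>If \<open>v\<close> has norm zero, the form is affine in \<open>b\<close>
        for \<open>a = 1\<close>; this value of \<open>b\<close> would make it
        \<open>-1\<close>.\<close>
      then show False
        using *[of 1 "- (?a + 1) / (2 * ?I)"] True by (simp add: field_simps)
    qed
    then show ?thesis using True by simp
  next
    case False
    then have "0 < ?b" by simp
    moreover have "0 \<le> ?b * (?a * ?b - ?I\<^sup>2)"
      using *[of ?b "- ?I"] by (simp add: power2_eq_square algebra_simps)
    ultimately show ?thesis
      by (simp add: zero_le_mult_iff)
  qed
  then have "\<bar>?I\<bar>\<^sup>2 \<le> (L2_norm T u * L2_norm T v)\<^sup>2"
    by (simp add: power_mult_distrib)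
  then show ?thesis
    by (rule power2_le_imp_le) simp
qed

lemma L2_norm_triangle:
  assumes "u \<in> L2 T" "v \<in> L2 T"
  shows "L2_norm T (\<lambda>t. u t + v t) \<le> L2_norm T u + L2_norm T v"
proof (rule power2_le_imp_le)
  show "(L2_norm T (\<lambda>t. u t + v t))\<^sup>2 \<le> (L2_norm T u + L2_norm T v)\<^sup>2"
    using L2_norm_squared_lincomb[OF assms, of 1 1] L2_Cauchy_Schwarz[OF assms]
    by (simp add: power2_sum)
qed simp

lemma L2_norm_minus_commute: "L2_norm T (\<lambda>t. u t - v t) = L2_norm T (\<lambda>t. v t - u t)"
  by (simp add: L2_norm_def power2_commute)

lemma L2_norm_triangle_diff:
  assumes "u \<in> L2 T" "v \<in> L2 T" "w \<in> L2 T"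
  shows "L2_norm T (\<lambda>t. u t - w t) \<le> L2_norm T (\<lambda>t. u t - v t) + L2_norm T (\<lambda>t. v t - w t)"
  using L2_norm_triangle[OF L2_diff L2_diff, OF assms(1,2) assms(2,3)] by simp

lemma L2_norm_diff_ineq:
  assumes "u \<in> L2 T" "v \<in> L2 T"
  shows "\<bar>L2_norm T u - L2_norm T v\<bar> \<le> L2_norm T (\<lambda>t. u t - v t)"
  using L2_norm_triangle[OF L2_diff[OF assms] assms(2)]
    L2_norm_triangle[OF L2_diff[OF assms(2,1)] assms(1)] L2_norm_minus_commute[of T u v]
  by simp

lemma L2_norm_cong_AE:
  assumes "u \<in> L2 T" "v \<in> L2 T" "AE t in lebesgue_on {0<..<T}. u t = v t"
  shows "L2_norm T u = L2_norm T v"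
  unfolding L2_norm_def using assms
  by (intro arg_cong[where f = sqrt] integral_cong_AE)
    (auto dest!: L2_measurable elim!: eventually_mono)

lemma L2_norm_sum_le:
  assumes "finite I" "\<And>i. i \<in> I \<Longrightarrow> u i \<in> L2 T"
  shows "L2_norm T (\<lambda>t. \<Sum>i\<in>I. u i t) \<le> (\<Sum>i\<in>I. L2_norm T (u i))"
  using assms
proof (induction I)
  case empty
  then show ?case by (simp add: L2_norm_def)
next
  case (insert i I)
  then show ?case
    using L2_norm_triangle[of "u i" T "\<lambda>t. \<Sum>i\<in>I. u i t"] by (simp add: L2_sum)
qed

section \<open>Passage to almost everywhere limits and completeness\<close>

lemma Fatou_L2:
  assumes f: "\<And>k. f k \<in> L2 T" and g: "g \<in> borel_measurable (lebesgue_on {0<..<T})"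
    and lim: "AE t in lebesgue_on {0<..<T}. (\<lambda>k. f k t) \<longlonglongrightarrow> g t"
    and bound: "\<forall>\<^sub>F k in sequentially. L2_norm T (f k) \<le> B" and "0 \<le> B"
  shows "g \<in> L2 T" "L2_norm T g \<le> B"
proof -
  let ?M = "lebesgue_on {0<..<T}"
  have [measurable]: "f k \<in> borel_measurable ?M" for k
    using f by (rule L2_measurable)
  note g [measurable]
  have "(\<integral>\<^sup>+ t. ennreal ((g t)\<^sup>2) \<partial>?M) = (\<integral>\<^sup>+ t. liminf (\<lambda>k. ennreal ((f k t)\<^sup>2)) \<partial>?M)"
    using lim
    by (intro nn_integral_cong_AE)
      (auto elim!: eventually_mono intro!: tendsto_intros lim_imp_Liminf[symmetric])
  also have "\<dots> \<le> liminf (\<lambda>k. \<integral>\<^sup>+ t. ennreal ((f k t)\<^sup>2) \<partial>?M)"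
    by (intro nn_integral_liminf) simp
  also have "\<dots> \<le> ennreal (B\<^sup>2)"
  proof (rule Liminf_le)
    show "\<forall>\<^sub>F k in sequentially. (\<integral>\<^sup>+ t. ennreal ((f k t)\<^sup>2) \<partial>?M) \<le> ennreal (B\<^sup>2)"
      using bound
    proof eventually_elim
      case (elim k)
      have "(\<integral>\<^sup>+ t. ennreal ((f k t)\<^sup>2) \<partial>?M) = ennreal ((L2_norm T (f k))\<^sup>2)"
        unfolding L2_norm_squared using L2_square_integrable[OF f] by (intro nn_integral_eq_integral) auto
      then show ?case
        using elim by (simp add: ennreal_leI power_mono)
    qed
  qed simp
  finally have le: "(\<integral>\<^sup>+ t. ennreal ((g t)\<^sup>2) \<partial>?M) \<le> ennreal (B\<^sup>2)" .
  then have int: "integrable ?M (\<lambda>t. (g t)\<^sup>2)"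
    by (intro integrableI_bounded) (auto intro: le_less_trans)
  then show "g \<in> L2 T"
    using g by (simp add: L2_def)
  have "ennreal ((L2_norm T g)\<^sup>2) \<le> ennreal (B\<^sup>2)"
    using le unfolding L2_norm_squared by (subst (asm) nn_integral_eq_integral[OF int]) auto
  then have "(L2_norm T g)\<^sup>2 \<le> B\<^sup>2"
    by (simp add: ennreal_le_iff)
  then show "L2_norm T g \<le> B"
    using \<open>0 \<le> B\<close> by (rule power2_le_imp_le)
qed

text \<open>Riesz-Fischer for representatives. The subsequence \<open>r\<close> is part of the
  conclusion because pointwise constraints survive almost everywhere convergence, which norm
  convergence of the whole sequence does not give.\<close>

theorem L2_complete:
  assumes u: "\<And>n. u n \<in> L2 T"
    and Cauchy: "\<And>e. 0 < e \<Longrightarrow> \<exists>K. \<forall>m\<ge>K. \<forall>n\<ge>K. L2_norm T (\<lambda>t. u m t - u n t) < e"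
  obtains v r where "v \<in> L2 T" "strict_mono r"
    "AE t in lebesgue_on {0<..<T}. (\<lambda>k. u (r k) t) \<longlonglongrightarrow> v t"
    "(\<lambda>n. L2_norm T (\<lambda>t. u n t - v t)) \<longlonglongrightarrow> 0"
proof -
  let ?M = "lebesgue_on {0<..<T}"
  have [measurable]: "u k \<in> borel_measurable ?M" for k
    using u by (rule L2_measurable)
  \<comment> \<open>Geometric closeness of the whole tail after \<open>r k\<close> makes the
    increments along the subsequence summable.\<close>
  have "\<exists>r. \<forall>k. (\<forall>m\<ge>r k. L2_norm T (\<lambda>t. u m t - u (r k) t) < (1 / 2) ^ k) \<and> r k < r (Suc k)"
  proof (rule dependent_nat_choice)
    show "\<exists>N. \<forall>m\<ge>N. L2_norm T (\<lambda>t. u m t - u N t) < (1 / 2) ^ 0"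
      using Cauchy[of 1] by auto
  next
    fix N k
    obtain K where "\<And>m n. K \<le> m \<Longrightarrow> K \<le> n \<Longrightarrow> L2_norm T (\<lambda>t. u m t - u n t) < (1 / 2) ^ Suc k"
      using Cauchy[of "(1 / 2) ^ Suc k"] by auto
    then show "\<exists>N'. (\<forall>m\<ge>N'. L2_norm T (\<lambda>t. u m t - u N' t) < (1 / 2) ^ Suc k) \<and> N < N'"
      by (intro exI[of _ "max K (Suc N)"]) auto
  qed
  then obtain r where r: "\<And>k m. r k \<le> m \<Longrightarrow> L2_norm T (\<lambda>t. u m t - u (r k) t) < (1 / 2) ^ k"
    and "\<And>k. r k < r (Suc k)" by blast
  then have mono: "strict_mono r" by (simp add: strict_mono_Suc_iff)
  define d where "d k t = \<bar>u (r (Suc k)) t - u (r k) t\<bar>" for k t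
  have d_meas [measurable]: "d k \<in> borel_measurable ?M" for k
    unfolding d_def by measurable
  \<comment> \<open>Cauchy-Schwarz against the constant 1 turns the L2 bound on an increment into an
    L1 bound, the interval being bounded.\<close>
  have d_le: "(\<integral>\<^sup>+ t. ennreal (d k t) \<partial>?M) \<le> ennreal (L2_norm T (\<lambda>_. 1) * (1 / 2) ^ k)" for k
  proof -
    have "(\<lambda>t. u (r (Suc k)) t - u (r k) t) \<in> L2 T"
      using u by (intro L2_diff)
    then have d: "d k \<in> L2 T"
      unfolding d_def L2_def by (auto simp: power2_abs)
    have "L2_norm T (d k) = L2_norm T (\<lambda>t. u (r (Suc k)) t - u (r k) t)"
      by (simp add: d_def L2_norm_def)
    also have "\<dots> \<le> (1 / 2) ^ k"
      using r[of k "r (Suc k)"] mono by (simp add: strict_mono_less_eq less_imp_le)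
    finally have "L2_norm T (\<lambda>_. 1) * L2_norm T (d k) \<le> L2_norm T (\<lambda>_. 1) * (1 / 2) ^ k"
      by (intro mult_left_mono) auto
    moreover have "(\<integral>t. d k t \<partial>?M) \<le> L2_norm T (\<lambda>_. 1) * L2_norm T (d k)"
      using L2_Cauchy_Schwarz[OF L2_const d, of 1] by simp
    moreover have "integrable ?M (d k)"
      using L2_mult_integrable[OF L2_const d, of 1] by simp
    then have "(\<integral>\<^sup>+ t. ennreal (d k t) \<partial>?M) = ennreal (\<integral>t. d k t \<partial>?M)"
      by (rule nn_integral_eq_integral) (simp add: d_def)
    ultimately show ?thesis
      by (simp add: ennreal_leI)
  qed
  \<comment> \<open>The sum of the absolute increments has finite integral, so it is finite almost
    everywhere and the telescoping series converges absolutely there.\<close>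
  have "(\<integral>\<^sup>+ t. (\<Sum>k. ennreal (d k t)) \<partial>?M) = (\<Sum>k. \<integral>\<^sup>+ t. ennreal (d k t) \<partial>?M)"
    by (intro nn_integral_suminf) measurable
  also have "\<dots> \<le> (\<Sum>k. ennreal (L2_norm T (\<lambda>_. 1) * (1 / 2) ^ k))"
    by (intro suminf_le d_le) auto
  also have "\<dots> = ennreal (\<Sum>k. L2_norm T (\<lambda>_. 1) * (1 / 2) ^ k)"
    by (intro suminf_ennreal2 summable_mult summable_geometric) auto
  finally have "(\<integral>\<^sup>+ t. (\<Sum>k. ennreal (d k t)) \<partial>?M) \<noteq> \<infinity>"
    by (auto simp: top_unique)
  then have "AE t in ?M. (\<Sum>k. ennreal (d k t)) \<noteq> \<infinity>"
    by (intro nn_integral_PInf_AE) measurable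
  then have conv: "AE t in ?M. convergent (\<lambda>k. u (r k) t)"
  proof eventually_elim
    case (elim t)
    then have "summable (\<lambda>k. d k t)"
      by (intro summable_suminf_not_top) (auto simp: d_def)
    then have "summable (\<lambda>k. u (r (Suc k)) t - u (r k) t)"
      unfolding d_def by (rule summable_rabs_cancel)
    then have "(\<lambda>n. u (r n) t - u (r 0) t) \<longlonglongrightarrow> (\<Sum>k. u (r (Suc k)) t - u (r k) t)"
      using summable_LIMSEQ[of "\<lambda>k. u (r (Suc k)) t - u (r k) t"]
      by (simp add: sum_lessThan_telescope[of "\<lambda>k. u (r k) t"])
    from tendsto_add[OF this tendsto_const[of "u (r 0) t"]]
    have "(\<lambda>n. u (r n) t) \<longlonglongrightarrow> (\<Sum>k. u (r (Suc k)) t - u (r k) t) + u (r 0) t"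
      by simp
    then show ?case
      by (rule convergentI)
  qed
  define v where "v t = lim (\<lambda>k. u (r k) t)" for t
  have v_meas [measurable]: "v \<in> borel_measurable ?M"
    unfolding v_def by (rule borel_measurable_lim_metric) measurable
  have lim: "AE t in ?M. (\<lambda>k. u (r k) t) \<longlonglongrightarrow> v t"
    using conv by eventually_elim (simp add: v_def convergent_LIMSEQ_iff)
  \<comment> \<open>Keep \<open>n\<close> fixed and let the other index run along the subsequence:
    Fatou carries the Cauchy estimate over to the limit.\<close>
  have diff: "(\<lambda>t. u n t - v t) \<in> L2 T \<and> L2_norm T (\<lambda>t. u n t - v t) \<le> e"
    if K: "\<forall>m\<ge>K. \<forall>n\<ge>K. L2_norm T (\<lambda>t. u m t - u n t) < e" and "K \<le> n" "0 < e" for K n e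
  proof -
    have f: "(\<lambda>t. u n t - u (r k) t) \<in> L2 T" for k
      using u by (intro L2_diff)
    have "\<forall>\<^sub>F k in sequentially. L2_norm T (\<lambda>t. u n t - u (r k) t) \<le> e"
      using eventually_ge_at_top[of K]
    proof eventually_elim
      case (elim k)
      then have "K \<le> r k"
        using seq_suble[OF mono, of k] by simp
      then show ?case
        using K \<open>K \<le> n\<close> by (intro less_imp_le) simp
    qed
    moreover have "AE t in ?M. (\<lambda>k. u n t - u (r k) t) \<longlonglongrightarrow> u n t - v t"
      using lim by eventually_elim (intro tendsto_intros)
    ultimately show ?thesis
      using Fatou_L2[of "\<lambda>k t. u n t - u (r k) t" T "\<lambda>t. u n t - v t" e] f \<open>0 < e\<close> by auto
  qed
  obtain K where "\<forall>m\<ge>K. \<forall>n\<ge>K. L2_norm T (\<lambda>t. u m t - u n t) < 1"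
    using Cauchy[of 1] by auto
  then have "(\<lambda>t. u K t - v t) \<in> L2 T"
    using diff[of K 1 K] by simp
  then have v: "v \<in> L2 T"
    using L2_diff[OF u[of K]] by fastforce
  have "(\<lambda>n. L2_norm T (\<lambda>t. u n t - v t)) \<longlonglongrightarrow> 0"
  proof (rule LIMSEQ_I)
    fix e :: real assume "0 < e"
    then obtain K where "\<forall>m\<ge>K. \<forall>n\<ge>K. L2_norm T (\<lambda>t. u m t - u n t) < e / 2"
      using Cauchy[of "e / 2"] by auto
    then have "\<forall>n\<ge>K. L2_norm T (\<lambda>t. u n t - v t) \<le> e / 2"
      using diff[of K "e / 2"] \<open>0 < e\<close> by auto
    then show "\<exists>K. \<forall>n\<ge>K. norm (L2_norm T (\<lambda>t. u n t - v t) - 0) < e"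
      using \<open>0 < e\<close> by (intro exI[of _ K]) fastforce
  qed
  with v mono lim show thesis by (rule that)
qed

section \<open>Translations\<close>

text \<open>The cut-off encodes the zero initial state: up to time \<open>a\<close> none of the
  inflow has arrived.\<close>

definition shift :: "real \<Rightarrow> (real \<Rightarrow> real) \<Rightarrow> real \<Rightarrow> real" where
  "shift a u t = (if t - a > 0 then u (t - a) else 0)"

text \<open>For nonnegative delays \<open>t - a - b > 0\<close> already implies
  \<open>t - a > 0\<close>, so the two cut-offs merge into one.\<close>

lemma shift_shift: "0 \<le> a \<Longrightarrow> 0 \<le> b \<Longrightarrow> shift a (shift b u) = shift (a + b) u"
  by (auto simp: shift_def fun_eq_iff algebra_simps)

lemma translation_measurable: "(\<lambda>t. t - a) \<in> lebesgue \<rightarrow>\<^sub>M lebesgue" for a :: real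
  using lebesgue_affine_measurable[where c = "\<lambda>_. 1" and t = "- a"] by simp

lemma AE_lebesgue_translation:
  fixes a :: real
  assumes "AE t in lebesgue. P t"
  shows "AE t in lebesgue. P (t - a)"
proof -
  have "lebesgue = density (distr lebesgue lebesgue (\<lambda>t. t - a)) (\<lambda>_. 1)"
    using lebesgue_real_affine[of 1 "- a"] by simp
  then have "distr lebesgue lebesgue (\<lambda>t. t - a) = lebesgue"
    unfolding density_1 by (rule sym)
  then show ?thesis
    using assms AE_distrD[OF translation_measurable[of a], of P] by metis
qed

lemma continuous_lebesgue_measurable:
  fixes g :: "real \<Rightarrow> real"
  shows "continuous_on UNIV g \<Longrightarrow> g \<in> borel_measurable lebesgue"
  by (intro measurable_completion) (simp add: borel_measurable_continuous_onI)

text \<open>The norm over the whole line is translation invariant and dominates the one over the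
  interval. That the bound does not depend on \<open>a\<close> is what the later approximation
  argument relies on.\<close>

lemma translate_L2:
  assumes f: "f \<in> borel_measurable lebesgue" and int: "integrable lebesgue (\<lambda>t. (f t)\<^sup>2)"
  shows "(\<lambda>t. f (t - a)) \<in> L2 T" "L2_norm T (\<lambda>t. f (t - a)) \<le> sqrt (\<integral>t. (f t)\<^sup>2 \<partial>lebesgue)"
proof -
  let ?S = "{0<..<T}"
  have int': "integrable lebesgue (\<lambda>t. (f (t - a))\<^sup>2)"
    using lebesgue_integrable_real_affine_iff[of 1 "\<lambda>t. (f t)\<^sup>2" "- a"] int by simp
  then have intS: "integrable (lebesgue_on ?S) (\<lambda>t. (f (t - a))\<^sup>2)"
    using integrable_mult_indicator[OF _ int', of ?S]
      integrable_restrict_space[of ?S lebesgue "\<lambda>t. (f (t - a))\<^sup>2"] by simp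
  show "(\<lambda>t. f (t - a)) \<in> L2 T"
    unfolding L2_def
    using intS measurable_compose[OF translation_measurable f] by (auto intro: measurable_restrict_space1)
  have "(\<integral>t. (f (t - a))\<^sup>2 \<partial>lebesgue_on ?S) = (\<integral>t. indicator ?S t *\<^sub>R (f (t - a))\<^sup>2 \<partial>lebesgue)"
    by (rule integral_restrict_space) auto
  also have "\<dots> \<le> (\<integral>t. (f (t - a))\<^sup>2 \<partial>lebesgue)"
    using int' by (intro integral_mono integrable_mult_indicator) (auto simp: indicator_def)
  also have "\<dots> = (\<integral>t. (f t)\<^sup>2 \<partial>lebesgue)"
    using lebesgue_integral_real_affine[of 1 "\<lambda>t. (f t)\<^sup>2" "- a"] by simp
  finally show "L2_norm T (\<lambda>t. f (t - a)) \<le> sqrt (\<integral>t. (f t)\<^sup>2 \<partial>lebesgue)"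
    unfolding L2_norm_def by simp
qed

section \<open>Extension by zero and bounds for delays\<close>

definition zero_ext :: "real \<Rightarrow> (real \<Rightarrow> real) \<Rightarrow> real \<Rightarrow> real" where
  "zero_ext T u t = (if t \<in> {0<..<T} then u t else 0)"

lemma zero_ext_measurable: "u \<in> L2 T \<Longrightarrow> zero_ext T u \<in> borel_measurable lebesgue"
  unfolding zero_ext_def by (intro borel_measurable_if_I L2_measurable) auto

lemma zero_ext_squared: "(zero_ext T u t)\<^sup>2 = indicator {0<..<T} t *\<^sub>R (u t)\<^sup>2"
  by (simp add: zero_ext_def)

lemma zero_ext_square_integrable: "u \<in> L2 T \<Longrightarrow> integrable lebesgue (\<lambda>t. (zero_ext T u t)\<^sup>2)"
  using integrable_restrict_space[of "{0<..<T}" lebesgue "\<lambda>t. (u t)\<^sup>2"]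
  unfolding zero_ext_squared by (simp add: L2_square_integrable)

lemma integral_zero_ext_squared: "(\<integral>t. (zero_ext T u t)\<^sup>2 \<partial>lebesgue) = (L2_norm T u)\<^sup>2"
  using integral_restrict_space[of "{0<..<T}" lebesgue "\<lambda>t. (u t)\<^sup>2"]
  unfolding zero_ext_squared L2_norm_squared by simp

text \<open>Since \<open>t < T\<close> and \<open>0 \<le> a\<close> force \<open>t - a < T\<close>,
  the only active cut-off of the extension is the one at 0. A delay thus becomes a genuine
  translation on the line.\<close>

lemma shift_eq_zero_ext: "0 \<le> a \<Longrightarrow> t \<in> {0<..<T} \<Longrightarrow> shift a u t = zero_ext T u (t - a)"
  by (auto simp: shift_def zero_ext_def)

lemma L2_cong: "(\<And>t. t \<in> {0<..<T} \<Longrightarrow> u t = v t) \<Longrightarrow> u \<in> L2 T \<longleftrightarrow> v \<in> L2 T"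
  unfolding L2_def mem_Collect_eq
  by (intro conj_cong measurable_cong Bochner_Integration.integrable_cong) auto

lemma L2_norm_cong: "(\<And>t. t \<in> {0<..<T} \<Longrightarrow> u t = v t) \<Longrightarrow> L2_norm T u = L2_norm T v"
  unfolding L2_norm_def by (intro arg_cong[where f = sqrt] Bochner_Integration.integral_cong) auto

lemma shift_in_L2:
  assumes "u \<in> L2 T" "0 \<le> a"
  shows "shift a u \<in> L2 T"
  using translate_L2(1)[OF zero_ext_measurable zero_ext_square_integrable, OF assms(1) assms(1)]
    L2_cong[of T "shift a u" "\<lambda>t. zero_ext T u (t - a)"] shift_eq_zero_ext[OF assms(2)] by simp

lemma L2_norm_shift_le:
  assumes "u \<in> L2 T" "0 \<le> a"
  shows "L2_norm T (shift a u) \<le> L2_norm T u"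
  using translate_L2(2)[OF zero_ext_measurable zero_ext_square_integrable, OF assms(1) assms(1), of T a]
    L2_norm_cong[of T "shift a u" "\<lambda>t. zero_ext T u (t - a)"] shift_eq_zero_ext[OF assms(2)]
    by (simp add: integral_zero_ext_squared)

text \<open>The exceptional null set is translated along. A nonnegative delay looks back only into
  the interval or into the cut-off region, never beyond \<open>T\<close>.\<close>

lemma shift_cong_AE:
  assumes "AE t in lebesgue_on {0<..<T}. u t = v t" "0 \<le> a"
  shows "AE t in lebesgue_on {0<..<T}. shift a u t = shift a v t"
proof -
  have "AE t in lebesgue. t \<in> {0<..<T} \<longrightarrow> u t = v t"
    using assms(1) by (subst (asm) AE_restrict_space_iff) auto
  then have "AE t in lebesgue. t - a \<in> {0<..<T} \<longrightarrow> u (t - a) = v (t - a)"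
    by (rule AE_lebesgue_translation)
  then have "AE t in lebesgue. t \<in> {0<..<T} \<longrightarrow> shift a u t = shift a v t"
  proof eventually_elim
    case (elim t)
    then show ?case using \<open>0 \<le> a\<close> by (auto simp: shift_def)
  qed
  then show ?thesis
    by (subst AE_restrict_space_iff) auto
qed

section \<open>Approximation by bounded continuous functions\<close>

lemma square_sum_le: "(a + b)\<^sup>2 \<le> 2 * a\<^sup>2 + 2 * b\<^sup>2" for a b :: real
  using sum_squares_bound[of a b] by (simp add: power2_sum)

lemma integrable_square_diff:
  fixes f g :: "'a \<Rightarrow> real"
  assumes "f \<in> borel_measurable M" "g \<in> borel_measurable M"
    and "integrable M (\<lambda>x. (f x)\<^sup>2)" "integrable M (\<lambda>x. (g x)\<^sup>2)"
  shows "integrable M (\<lambda>x. (f x - g x)\<^sup>2)"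
proof (rule Bochner_Integration.integrable_bound)
  show "integrable M (\<lambda>x. 2 * (f x)\<^sup>2 + 2 * (g x)\<^sup>2)"
    using assms by simp
  show "(\<lambda>x. (f x - g x)\<^sup>2) \<in> borel_measurable M"
    using assms by measurable
  have "norm ((f x - g x)\<^sup>2) \<le> norm (2 * (f x)\<^sup>2 + 2 * (g x)\<^sup>2)" for x
    using square_sum_le[of "f x" "- g x"] by simp
  then show "AE x in M. norm ((f x - g x)\<^sup>2) \<le> norm (2 * (f x)\<^sup>2 + 2 * (g x)\<^sup>2)"
    by simp
qed

definition clip :: "real \<Rightarrow> real \<Rightarrow> real" where
  "clip M x = max (- M) (min M x)"

lemma clip_le: "0 \<le> M \<Longrightarrow> \<bar>clip M x\<bar> \<le> M"
  and clip_eq: "\<bar>x\<bar> \<le> M \<Longrightarrow> clip M x = x"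
  and clip_diff_le: "0 \<le> M \<Longrightarrow> \<bar>x - clip M x\<bar> \<le> \<bar>x\<bar>"
  and clip_0: "0 \<le> M \<Longrightarrow> clip M 0 = 0"
  by (auto simp: clip_def)

text \<open>Dominated convergence with majorant \<open>w\<close> squared; at each point the
  truncation is exact from some index on.\<close>

lemma clip_approx:
  assumes [measurable]: "w \<in> borel_measurable M" and int: "integrable M (\<lambda>t. (w t)\<^sup>2)"
  shows "(\<lambda>n. \<integral>t. (w t - clip (real n) (w t))\<^sup>2 \<partial>M) \<longlonglongrightarrow> 0"
proof -
  have "(\<lambda>n. \<integral>t. (w t - clip (real n) (w t))\<^sup>2 \<partial>M) \<longlonglongrightarrow> (\<integral>t. 0 \<partial>M)"
  proof (rule integral_dominated_convergence)
    show "integrable M (\<lambda>t. (w t)\<^sup>2)" by (rule int)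
    show "(\<lambda>t. (w t - clip (real n) (w t))\<^sup>2) \<in> borel_measurable M" for n
      unfolding clip_def by measurable
    show "AE t in M. norm ((w t - clip (real n) (w t))\<^sup>2) \<le> (w t)\<^sup>2" for n
      using clip_diff_le[of "real n"] by (auto simp: abs_le_square_iff)
    have "(\<lambda>n. (w t - clip (real n) (w t))\<^sup>2) \<longlonglongrightarrow> 0" for t
    proof (rule tendsto_eventually)
      obtain K :: nat where "\<bar>w t\<bar> \<le> real K" using real_arch_simple by blast
      then show "\<forall>\<^sub>F n in sequentially. (w t - clip (real n) (w t))\<^sup>2 = 0"
        by (intro eventually_sequentiallyI[of K]) (simp add: clip_eq)
    qed
    then show "AE t in M. (\<lambda>n. (w t - clip (real n) (w t))\<^sup>2) \<longlonglongrightarrow> 0" by simp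
  qed simp
  then show ?thesis by simp
qed

text \<open>Lusin: measurable functions are almost everywhere limits of continuous ones. Clipping and
  cutting these off outside a bounded interval makes dominated convergence applicable.\<close>

lemma continuous_approx_bounded:
  fixes w :: "real \<Rightarrow> real"
  assumes w: "w \<in> borel_measurable lebesgue"
    and bound: "\<And>t. \<bar>w t\<bar> \<le> B" and supp: "\<And>t. R < \<bar>t\<bar> \<Longrightarrow> w t = 0" and "0 < e"
  obtains g where "continuous_on UNIV g" "\<And>t. \<bar>g t\<bar> \<le> B"
    "integrable lebesgue (\<lambda>t. (g t)\<^sup>2)" "(\<integral>t. (w t - g t)\<^sup>2 \<partial>lebesgue) < e"
proof -
  have "0 \<le> B" using bound[of 0] by simp
  have "w measurable_on UNIV"
    using w by (simp add: measurable_on_iff_borel_measurable)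
  then obtain N g where N: "negligible N" and cont: "\<And>n. continuous_on UNIV (g n)"
    and lim: "\<And>x. x \<notin> N \<Longrightarrow> (\<lambda>n. g n x) \<longlonglongrightarrow> w x"
    by (auto simp: measurable_on_def)
  \<comment> \<open>A continuous cut-off: 1 on the support of \<open>w\<close>, 0 once
    \<open>\<bar>t\<bar>\<close> reaches \<open>R + 1\<close>.\<close>
  define \<phi> where "\<phi> t = max 0 (min 1 (R + 1 - \<bar>t\<bar>))" for t
  define h where "h n t = \<phi> t * clip B (g n t)" for n t
  let ?D = "\<lambda>t. indicator {- R - 1 .. R + 1} t *\<^sub>R (2 * B)\<^sup>2"
  have cont_h: "continuous_on UNIV (h n)" for n
    unfolding h_def \<phi>_def clip_def by (intro continuous_intros cont)
  then have [measurable]: "h n \<in> borel_measurable lebesgue" for n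
    by (rule continuous_lebesgue_measurable)
  note w [measurable]
  have h_bound: "\<bar>h n t\<bar> \<le> B" for n t
    using mult_mono[of "\<bar>\<phi> t\<bar>" 1 "\<bar>clip B (g n t)\<bar>" B] clip_le[OF \<open>0 \<le> B\<close>] \<open>0 \<le> B\<close>
    by (auto simp: h_def \<phi>_def abs_mult)
  have h_supp: "h n t = 0" if "t \<notin> {- R - 1 .. R + 1}" for n t
    using that by (auto simp: h_def \<phi>_def)
  have D: "integrable lebesgue ?D"
    by (intro integrable_scaleR_left integrable_real_indicator) (auto simp: emeasure_lborel_Icc_eq)
  have "(\<lambda>n. \<integral>t. (w t - h n t)\<^sup>2 \<partial>lebesgue) \<longlonglongrightarrow> (\<integral>t. 0 \<partial>(lebesgue :: real measure))"
  proof (rule integral_dominated_convergence[OF _ _ D])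
    have "\<bar>w t - h n t\<bar> \<le> 2 * B" for n t
      using bound[of t] h_bound[of n t] by linarith
    then have "(w t - h n t)\<^sup>2 \<le> (2 * B)\<^sup>2" for n t
      using \<open>0 \<le> B\<close> by (intro abs_le_square_iff[THEN iffD1]) simp
    then show "AE t in lebesgue. norm ((w t - h n t)\<^sup>2) \<le> ?D t" for n
      by (intro AE_I2) (auto simp: indicator_def h_supp supp)
    have "(\<lambda>n. (w t - h n t)\<^sup>2) \<longlonglongrightarrow> 0" if "t \<notin> N" for t
    proof -
      have "(\<lambda>n. h n t) \<longlonglongrightarrow> \<phi> t * clip B (w t)"
        unfolding h_def clip_def by (intro tendsto_intros lim that)
      \<comment> \<open>Neither modification affects the limit: \<open>w\<close> is bounded by
        \<open>B\<close>, and it vanishes wherever the cut-off differs from 1.\<close>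
      also have "\<phi> t * clip B (w t) = w t"
        using bound[of t] supp[of t] by (cases "R < \<bar>t\<bar>") (auto simp: clip_eq clip_0 \<phi>_def)
      finally have "(\<lambda>n. (w t - h n t)\<^sup>2) \<longlonglongrightarrow> (w t - w t)\<^sup>2"
        by (intro tendsto_intros)
      then show ?thesis by simp
    qed
    then show "AE t in lebesgue. (\<lambda>n. (w t - h n t)\<^sup>2) \<longlonglongrightarrow> 0"
      using N by (intro AE_I'[of N]) (auto simp: negligible_iff_null_sets)
  qed measurable
  then have "\<forall>\<^sub>F n in sequentially. (\<integral>t. (w t - h n t)\<^sup>2 \<partial>lebesgue) < e"
    using \<open>0 < e\<close> by (intro order_tendstoD) auto
  then obtain n where n: "(\<integral>t. (w t - h n t)\<^sup>2 \<partial>lebesgue) < e"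
    by (auto simp: eventually_sequentially)
  have "integrable lebesgue (\<lambda>t. (h n t)\<^sup>2)"
  proof (rule Bochner_Integration.integrable_bound[OF D])
    have "(h n t)\<^sup>2 \<le> (2 * B)\<^sup>2" for t
      using h_bound[of n t] \<open>0 \<le> B\<close> by (intro abs_le_square_iff[THEN iffD1]) simp
    then show "AE t in lebesgue. norm ((h n t)\<^sup>2) \<le> norm (?D t)"
      by (intro AE_I2) (auto simp: indicator_def h_supp)
  qed measurable
  with cont_h h_bound n show thesis by (intro that)
qed

text \<open>Truncation reduces to the bounded case. Each stage gets \<open>e / 4\<close> because the
  estimate for the square of a sum doubles both squared errors.\<close>

lemma continuous_approx:
  fixes w :: "real \<Rightarrow> real"
  assumes w [measurable]: "w \<in> borel_measurable lebesgue" and int: "integrable lebesgue (\<lambda>t. (w t)\<^sup>2)"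
    and supp: "\<And>t. R < \<bar>t\<bar> \<Longrightarrow> w t = 0" and "0 < e"
  obtains g B where "continuous_on UNIV g" "\<And>t. \<bar>g t\<bar> \<le> B"
    "integrable lebesgue (\<lambda>t. (g t)\<^sup>2)" "(\<integral>t. (w t - g t)\<^sup>2 \<partial>lebesgue) < e"
proof -
  have "\<forall>\<^sub>F n in sequentially. (\<integral>t. (w t - clip (real n) (w t))\<^sup>2 \<partial>lebesgue) < e / 4"
    using \<open>0 < e\<close> by (intro order_tendstoD[OF clip_approx[OF w int]]) auto
  then obtain n where n: "(\<integral>t. (w t - clip (real n) (w t))\<^sup>2 \<partial>lebesgue) < e / 4"
    by (auto simp: eventually_sequentially)
  define c where "c t = clip (real n) (w t)" for t
  have [measurable]: "c \<in> borel_measurable lebesgue"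
    unfolding c_def clip_def by measurable
  obtain g where g: "continuous_on UNIV g" "\<And>t. \<bar>g t\<bar> \<le> real n"
    "integrable lebesgue (\<lambda>t. (g t)\<^sup>2)" "(\<integral>t. (c t - g t)\<^sup>2 \<partial>lebesgue) < e / 4"
  proof (rule continuous_approx_bounded)
    show "\<bar>c t\<bar> \<le> real n" for t by (simp add: c_def clip_le)
    show "R < \<bar>t\<bar> \<Longrightarrow> c t = 0" for t by (simp add: c_def supp clip_0)
    show "0 < e / 4" using \<open>0 < e\<close> by simp
  qed measurable
  have [measurable]: "g \<in> borel_measurable lebesgue"
    using g(1) by (rule continuous_lebesgue_measurable)
  have int_c: "integrable lebesgue (\<lambda>t. (c t)\<^sup>2)"
  proof (rule Bochner_Integration.integrable_bound[OF int])
    show "AE t in lebesgue. norm ((c t)\<^sup>2) \<le> norm ((w t)\<^sup>2)"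
      by (auto simp: c_def clip_def abs_le_square_iff[symmetric])
  qed measurable
  have 1: "integrable lebesgue (\<lambda>t. (w t - c t)\<^sup>2)" and 2: "integrable lebesgue (\<lambda>t. (c t - g t)\<^sup>2)"
    and 3: "integrable lebesgue (\<lambda>t. (w t - g t)\<^sup>2)"
    by (intro integrable_square_diff int int_c g; measurable)+
  have "(w t - g t)\<^sup>2 \<le> 2 * (w t - c t)\<^sup>2 + 2 * (c t - g t)\<^sup>2" for t
    using square_sum_le[of "w t - c t" "c t - g t"] by simp
  then have "(\<integral>t. (w t - g t)\<^sup>2 \<partial>lebesgue) \<le> (\<integral>t. 2 * (w t - c t)\<^sup>2 + 2 * (c t - g t)\<^sup>2 \<partial>lebesgue)"
    using 1 2 3 by (intro integral_mono) auto
  also have "\<dots> = 2 * (\<integral>t. (w t - c t)\<^sup>2 \<partial>lebesgue) + 2 * (\<integral>t. (c t - g t)\<^sup>2 \<partial>lebesgue)"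
    using 1 2 by simp
  also have "\<dots> < e"
    using n g(4) unfolding c_def by linarith
  finally show thesis
    using g by (intro that)
qed

section \<open>Continuity of translations in L2\<close>

lemma translation_continuous_bounded:
  fixes g :: "real \<Rightarrow> real"
  assumes cont: "continuous_on UNIV g" and bound: "\<And>t. \<bar>g t\<bar> \<le> B"
  shows "((\<lambda>b. L2_norm T (\<lambda>t. g (t - b) - g (t - a))) \<longlongrightarrow> 0) (at a)"
  unfolding tendsto_at_iff_sequentially comp_def
proof (intro allI impI)
  fix b :: "nat \<Rightarrow> real" assume "\<forall>i. b i \<in> UNIV - {a}" and b: "b \<longlonglongrightarrow> a"
  let ?M = "lebesgue_on {0<..<T}"
  have "0 \<le> B" using bound[of 0] by simp
  have meas: "(\<lambda>t. g (t - c)) \<in> borel_measurable ?M" for c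
    by (intro measurable_restrict_space1 continuous_lebesgue_measurable
        continuous_on_compose2[OF cont] continuous_intros) auto
  have "(\<lambda>n. \<integral>t. (g (t - b n) - g (t - a))\<^sup>2 \<partial>?M) \<longlonglongrightarrow> (\<integral>t. 0 \<partial>?M)"
  proof (rule integral_dominated_convergence[where w = "\<lambda>_. (2 * B)\<^sup>2"])
    show "integrable ?M (\<lambda>_. (2 * B)\<^sup>2)"
      using L2_const[of "2 * B" T] by (rule L2_square_integrable)
    show "(\<lambda>t. (g (t - b n) - g (t - a))\<^sup>2) \<in> borel_measurable ?M" for n
      using meas by (intro borel_measurable_power borel_measurable_diff)
    have "\<bar>g (t - b n) - g (t - a)\<bar> \<le> 2 * B" for n t
      using bound[of "t - b n"] bound[of "t - a"] by linarith
    then have "(g (t - b n) - g (t - a))\<^sup>2 \<le> (2 * B)\<^sup>2" for n t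
      using \<open>0 \<le> B\<close> by (intro abs_le_square_iff[THEN iffD1]) simp
    then show "AE t in ?M. norm ((g (t - b n) - g (t - a))\<^sup>2) \<le> (2 * B)\<^sup>2" for n
      by simp
    have "(\<lambda>n. g (t - b n)) \<longlonglongrightarrow> g (t - a)" for t
      by (rule continuous_on_tendsto_compose[OF cont]) (auto intro!: tendsto_intros b)
    then have "(\<lambda>n. (g (t - b n) - g (t - a))\<^sup>2) \<longlonglongrightarrow> (g (t - a) - g (t - a))\<^sup>2" for t
      by (intro tendsto_intros)
    then show "AE t in ?M. (\<lambda>n. (g (t - b n) - g (t - a))\<^sup>2) \<longlonglongrightarrow> 0"
      by simp
  qed simp
  then show "(\<lambda>n. L2_norm T (\<lambda>t. g (t - b n) - g (t - a))) \<longlonglongrightarrow> 0"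
    unfolding L2_norm_def using tendsto_real_sqrt by fastforce
qed

text \<open>An \<open>e / 3\<close> argument: replace \<open>w\<close> by a continuous
  \<open>g\<close>, with an error that is the same for every translate, and use continuity of the
  translates of \<open>g\<close>. The tolerance is squared because the approximation controls the
  squared error.\<close>

lemma translation_continuous:
  fixes w :: "real \<Rightarrow> real"
  assumes w: "w \<in> borel_measurable lebesgue" and int: "integrable lebesgue (\<lambda>t. (w t)\<^sup>2)"
    and supp: "\<And>t. R < \<bar>t\<bar> \<Longrightarrow> w t = 0"
  shows "((\<lambda>b. L2_norm T (\<lambda>t. w (t - b) - w (t - a))) \<longlongrightarrow> 0) (at a)"
proof (rule tendstoI)
  fix e :: real assume "0 < e"
  then have "0 < (e / 3)\<^sup>2" by simp
  from continuous_approx[OF w int supp this]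
  obtain g B where cont: "continuous_on UNIV g" and bound: "\<And>t. \<bar>g t\<bar> \<le> B"
    and int_g: "integrable lebesgue (\<lambda>t. (g t)\<^sup>2)" and less: "(\<integral>t. (w t - g t)\<^sup>2 \<partial>lebesgue) < (e / 3)\<^sup>2"
    by blast
  have g: "g \<in> borel_measurable lebesgue"
    using cont by (rule continuous_lebesgue_measurable)
  have diff: "L2_norm T (\<lambda>t. w (t - b) - g (t - b)) < e / 3" for b
  proof -
    have "L2_norm T (\<lambda>t. w (t - b) - g (t - b)) \<le> sqrt (\<integral>t. (w t - g t)\<^sup>2 \<partial>lebesgue)"
      using w g int int_g by (intro translate_L2(2) integrable_square_diff borel_measurable_diff)
    also have "\<dots> < sqrt ((e / 3)\<^sup>2)"
      using less by (rule real_sqrt_less_mono)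
    finally show ?thesis using \<open>0 < e\<close> by simp
  qed
  have wL2: "(\<lambda>t. w (t - c)) \<in> L2 T" and gL2: "(\<lambda>t. g (t - c)) \<in> L2 T" for c
    by (rule translate_L2(1)[OF w int], rule translate_L2(1)[OF g int_g])
  have "\<forall>\<^sub>F b in at a. L2_norm T (\<lambda>t. g (t - b) - g (t - a)) < e / 3"
    using \<open>0 < e\<close> by (intro order_tendstoD[OF translation_continuous_bounded[OF cont bound]]) simp
  then show "\<forall>\<^sub>F b in at a. dist (L2_norm T (\<lambda>t. w (t - b) - w (t - a))) 0 < e"
  proof eventually_elim
    case (elim b)
    then show ?case
      using L2_norm_triangle_diff[OF wL2[of b] gL2[of b] wL2[of a]]
        L2_norm_triangle_diff[OF gL2[of b] gL2[of a] wL2[of a]]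
        diff[of b] diff[of a] L2_norm_minus_commute[of T "\<lambda>t. w (t - a)" "\<lambda>t. g (t - a)"]
      by simp
  qed
qed

text \<open>The limit is one-sided in the delay because \<open>shift\<close> agrees with translation
  of the zero extension only for nonnegative delays.\<close>

lemma shift_continuous:
  assumes "u \<in> L2 T" "0 \<le> a"
  shows "((\<lambda>b. L2_norm T (\<lambda>t. shift b u t - shift a u t)) \<longlongrightarrow> 0) (at a within {0..})"
proof -
  have "((\<lambda>b. L2_norm T (\<lambda>t. zero_ext T u (t - b) - zero_ext T u (t - a))) \<longlongrightarrow> 0) (at a)"
    using assms(1)
    by (intro translation_continuous[where R = T] zero_ext_measurable zero_ext_square_integrable)
      (auto simp: zero_ext_def)
  then have lim: "((\<lambda>b. L2_norm T (\<lambda>t. zero_ext T u (t - b) - zero_ext T u (t - a))) \<longlongrightarrow> 0) (at a within {0..})"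
    by (rule tendsto_within_subset) simp
  have "\<forall>\<^sub>F b in at a within {0..}. L2_norm T (\<lambda>t. zero_ext T u (t - b) - zero_ext T u (t - a)) =
      L2_norm T (\<lambda>t. shift b u t - shift a u t)"
    unfolding eventually_at_filter
    using \<open>0 \<le> a\<close> by (intro always_eventually allI impI L2_norm_cong) (simp add: shift_eq_zero_ext[where T = T])
  from Lim_transform_eventually[OF lim this] show ?thesis .
qed

section \<open>The solution operator\<close>

context
  fixes N :: network
  assumes N: "is_network N"
begin

lemma network_positive:
  "0 < horizon N" "0 < edge_len N" "k \<in> {1..num_edges N} \<Longrightarrow> 0 < velocity N k"
  using N by (auto simp: is_network_def)

lemma arc_in_range: "(i, k) \<in> parcs (net_graph N) \<Longrightarrow> i \<in> {0..num_edges N} \<and> k \<in> {1..num_edges N}"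
proof -
  assume arc: "(i, k) \<in> parcs (net_graph N)"
  have verts: "pverts (net_graph N) = {0..num_edges N}" and "pair_wf_digraph (net_graph N)"
    using N by (auto simp: is_network_def)
  then have "i \<in> {0..num_edges N}" "k \<in> {0..num_edges N}"
    using pair_wf_digraph.in_arcsD1[OF _ arc] pair_wf_digraph.in_arcsD2[OF _ arc] by auto
  moreover have "in_arcs (net_graph N) 0 = {}"
    using N by (simp add: is_network_def)
  then have "k \<noteq> 0"
    using arc by (auto simp: in_arcs_def)
  ultimately show ?thesis by auto
qed

lemma arc_from_source: "(0, k) \<in> parcs (net_graph N) \<longleftrightarrow> k = 1"
proof -
  have "out_arcs (net_graph N) 0 = {(0, 1)}"
    using N by (simp add: is_network_def)
  then have "(0, k) \<in> out_arcs (net_graph N) 0 \<longleftrightarrow> k = 1"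
    by simp
  then show ?thesis by (simp add: out_arcs_def)
qed

lemma one_in_range: "1 \<in> {1..num_edges N}"
  using arc_in_range[of 0 1] arc_from_source[of 1] by simp

lemma arc_tail_unique:
  assumes "(i, k) \<in> parcs (net_graph N)" "(j, k) \<in> parcs (net_graph N)"
  shows "i = j"
proof -
  have "card (in_arcs (net_graph N) k) = 1"
    using N arc_in_range[OF assms(1)] by (simp add: is_network_def)
  then obtain e where "in_arcs (net_graph N) k = {e}"
    by (auto simp: card_1_singleton_iff)
  moreover have "(i, k) \<in> in_arcs (net_graph N) k" "(j, k) \<in> in_arcs (net_graph N) k"
    using assms by (auto simp: in_arcs_def)
  ultimately show ?thesis by auto
qed

text \<open>The tail of an arc is never a demand vertex, so only the source remains to be
  excluded.\<close>

lemma inner_vertex_iff: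
  assumes "(i, k) \<in> parcs (net_graph N)"
  shows "i \<in> inner_vertices N \<longleftrightarrow> i \<noteq> 0"
proof -
  have "pverts (net_graph N) = {0..num_edges N}"
    using N by (simp add: is_network_def)
  moreover have "(i, k) \<in> out_arcs (net_graph N) i"
    using assms by (simp add: out_arcs_def)
  then have "out_arcs (net_graph N) i \<noteq> {}" by blast
  ultimately show ?thesis
    using arc_in_range[OF assms] unfolding inner_vertices_def demand_vertices_def by auto
qed

lemma inner_vertex_range: "i \<in> inner_vertices N \<Longrightarrow> i \<in> {1..num_edges N}"
  using N by (auto simp: inner_vertices_def is_network_def)

lemma demand_vertex_range: "i \<in> demand_vertices N \<Longrightarrow> i \<in> {1..num_edges N}"
proof -
  assume i: "i \<in> demand_vertices N"
  have "out_arcs (net_graph N) 0 \<noteq> {}" "pverts (net_graph N) = {0..num_edges N}"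
    using N by (auto simp: is_network_def)
  with i have "i \<noteq> 0" "i \<in> {0..num_edges N}"
    by (auto simp: demand_vertices_def)
  then show ?thesis by simp
qed

text \<open>The set of vertices reachable from the source is closed under successors, and also under
  predecessors because every vertex is the head of at most one edge; so connectedness of the
  underlying undirected graph makes it everything.\<close>

lemma reachable_from_source:
  assumes "v \<in> {0..num_edges N}"
  shows "(0, v) \<in> (parcs (net_graph N))\<^sup>*"
proof -
  let ?G = "with_proj (net_graph N)"
  let ?E = "parcs (net_graph N)"
  have verts: "pverts (net_graph N) = {0..num_edges N}"
    and conn: "Digraph_Component.connected ?G"
    using N by (auto simp: is_network_def undirected_tree_def)
  have sym: "parcs (mk_symmetric ?G) = ?E \<union> ?E\<inverse>"
    by (auto simp: mk_symmetric_def)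
  have "(0, v) \<in> rtrancl_on {0..num_edges N} (?E \<union> ?E\<inverse>)"
    using conn assms verts
    unfolding connected_def strongly_connected_def reachable_def with_proj_simps sym
    by (auto simp: mk_symmetric_def)
  then show ?thesis
  proof (induction rule: rtrancl_on_induct)
    case base
    show ?case by simp
  next
    case (step y z)
    from \<open>(y, z) \<in> ?E \<union> ?E\<inverse>\<close> consider "(y, z) \<in> ?E" | "(z, y) \<in> ?E" by auto
    then show ?case
    proof cases
      case 1
      with step.IH show ?thesis by (rule rtrancl_into_rtrancl)
    next
      case 2
      \<comment> \<open>A step against an arc: the path to \<open>y\<close> is nonempty and its last
        arc must come from \<open>z\<close>, the only predecessor of \<open>y\<close>; dropping that
        arc reaches \<open>z\<close>.\<close>
      then have "y \<noteq> 0" using arc_in_range by fastforce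
      with step.IH obtain x where "(0, x) \<in> ?E\<^sup>*" "(x, y) \<in> ?E"
        by (metis rtrancl.cases)
      with 2 show ?thesis using arc_tail_unique by blast
    qed
  qed
qed

end

text \<open>Induction along the directed path from the source, stated for edges: the only arc
  leaving the source is edge 1, which is therefore the base case.\<close>

lemma network_induct [consumes 2, case_names source inner]:
  assumes N: "is_network N" and "k \<in> {1..num_edges N}" and "P 1"
    and "\<And>i k. i \<in> inner_vertices N \<Longrightarrow> (i, k) \<in> parcs (net_graph N) \<Longrightarrow> P i \<Longrightarrow> P k"
  shows "P k"
proof -
  have "(0, k) \<in> (parcs (net_graph N))\<^sup>*"
    using assms(2) by (intro reachable_from_source[OF N]) auto
  \<comment> \<open>The path starts at vertex 0, which labels no edge; the disjunction lets the
    induction begin there.\<close>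
  then have "k = 0 \<or> P k"
  proof (induction rule: rtrancl_induct)
    case (step y z)
    then show ?case
      using \<open>P 1\<close> arc_from_source[OF N, of z] inner_vertex_iff[OF N, of y z] assms(4)[of y z] by auto
  qed simp
  with assms(2) show ?thesis by auto
qed

text \<open>The characteristic of edge \<open>k\<close> carries the inflow at the source, scaled by \<open>c\<close> and delayed by
  the travel time \<open>d\<close>, to the beginning of the edge.\<close>

inductive characteristic :: "network \<Rightarrow> nat \<Rightarrow> real \<Rightarrow> real \<Rightarrow> bool" for N :: network where
  source: "characteristic N 1 (1 / velocity N 1) 0"
| inner: "characteristic N i c d \<Longrightarrow> i \<in> inner_vertices N \<Longrightarrow> (i, k) \<in> parcs (net_graph N) \<Longrightarrow>
    characteristic N k (ratio N i k * (velocity N i / velocity N k) * c) (edge_len N / velocity N i + d)"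

lemma characteristic_exists:
  assumes "is_network N" "k \<in> {1..num_edges N}"
  shows "\<exists>c d. characteristic N k c d"
  using assms by (induction rule: network_induct) (blast intro: characteristic.intros)+

text \<open>The rules cannot compete: a head has one tail, and the tail of edge 1 is the source,
  which is not an inner vertex.\<close>

lemma characteristic_unique:
  assumes N: "is_network N"
  shows "characteristic N k c d \<Longrightarrow> characteristic N k c' d' \<Longrightarrow> c' = c \<and> d' = d"
proof (induction arbitrary: c' d' rule: characteristic.induct)
  case source
  show ?case
  proof (cases rule: characteristic.cases[OF source])
    case (2 i c d k)
    then have "i = 0"
      using arc_tail_unique[OF N, of i 1 0] arc_from_source[OF N, of 1] by simp
    then show ?thesis
      using 2 inner_vertex_range[OF N] by fastforce
  qed simp
next
  case (inner i c d k)
  show ?case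
  proof (cases rule: characteristic.cases[OF inner.prems])
    case 1
    then have "i = 0"
      using arc_tail_unique[OF N, of i 1 0] arc_from_source[OF N, of 1] inner.hyps by simp
    then show ?thesis
      using inner.hyps inner_vertex_range[OF N] by fastforce
  next
    case (2 j c d k)
    then have "j = i"
      using arc_tail_unique[OF N] inner.hyps by simp
    then show ?thesis
      using 2 inner.IH by simp
  qed
qed

text \<open>Scalings and delays as functions, available once the relation
  \<open>characteristic\<close> is known to be total on the edges and single-valued. Values at
  numbers that are not edges are unconstrained.\<close>

locale transport_network =
  fixes N :: network and c d :: "nat \<Rightarrow> real"
  assumes N: "is_network N"
    and c_source: "c 1 = 1 / velocity N 1" and d_source: "d 1 = 0"
    and c_inner: "i \<in> inner_vertices N \<Longrightarrow> (i, k) \<in> parcs (net_graph N) \<Longrightarrow>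
      c k = ratio N i k * (velocity N i / velocity N k) * c i"
    and d_inner: "i \<in> inner_vertices N \<Longrightarrow> (i, k) \<in> parcs (net_graph N) \<Longrightarrow>
      d k = edge_len N / velocity N i + d i"

lemma transport_network_exists:
  assumes N: "is_network N"
  obtains c d where "transport_network N c d"
proof -
  obtain c d where cd: "\<And>k. k \<in> {1..num_edges N} \<Longrightarrow> characteristic N k (c k) (d k)"
    using characteristic_exists[OF N] by metis
  have "c 1 = 1 / velocity N 1 \<and> d 1 = 0"
    by (rule characteristic_unique[OF N source cd[OF one_in_range[OF N]]])
  moreover have "c k = ratio N i k * (velocity N i / velocity N k) * c i \<and>
      d k = edge_len N / velocity N i + d i"
    if "i \<in> inner_vertices N" "(i, k) \<in> parcs (net_graph N)" for i k
    using that cd inner_vertex_range[OF N] arc_in_range[OF N]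
    by (intro characteristic_unique[OF N inner]) blast+
  ultimately have "transport_network N c d"
    using N by unfold_locales auto
  then show thesis by (rule that)
qed

section \<open>The state space and the explicit solution\<close>

lemma slice_norm_eq: "slice_norm N z x = L2_set (\<lambda>i. L2_norm (horizon N) (\<lambda>t. z (i, t, x))) {1..num_edges N}"
  by (simp add: slice_norm_def L2_set_def)

text \<open>The Euclidean slice norm lies between each single component and the sum of the finitely
  many components, so continuity can be checked edge by edge.\<close>

lemma state_space_iff:
  "z \<in> state_space N \<longleftrightarrow> (\<forall>x\<in>{0..edge_len N}. \<forall>i\<in>{1..num_edges N}. (\<lambda>t. z (i, t, x)) \<in> L2 (horizon N) \<and>
     ((\<lambda>y. L2_norm (horizon N) (\<lambda>t. z (i, t, y) - z (i, t, x))) \<longlongrightarrow> 0) (at x within {0..edge_len N}))"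
proof -
  let ?l = "\<lambda>i x y. L2_norm (horizon N) (\<lambda>t. z (i, t, y) - z (i, t, x))"
  have "((\<lambda>y. slice_norm N (\<lambda>(i, t, _). z (i, t, y) - z (i, t, x)) x) \<longlongrightarrow> 0) (at x within {0..edge_len N})
    \<longleftrightarrow> (\<forall>i\<in>{1..num_edges N}. (?l i x \<longlongrightarrow> 0) (at x within {0..edge_len N}))"
    (is "?L \<longleftrightarrow> ?R") for x
  proof
    assume ?L
    then have L: "((\<lambda>y. L2_set (\<lambda>i. ?l i x y) {1..num_edges N}) \<longlongrightarrow> 0) (at x within {0..edge_len N})"
      by (simp add: slice_norm_eq)
    show ?R
    proof
      fix i assume i: "i \<in> {1..num_edges N}"
      show "(?l i x \<longlongrightarrow> 0) (at x within {0..edge_len N})"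
        by (rule tendsto_sandwich[OF _ _ tendsto_const L])
          (use i in \<open>auto intro!: always_eventually member_le_L2_set\<close>)
    qed
  next
    assume R: ?R
    have "((\<lambda>y. \<Sum>i\<in>{1..num_edges N}. ?l i x y) \<longlongrightarrow> (\<Sum>i\<in>{1..num_edges N}. 0)) (at x within {0..edge_len N})"
      using R by (intro tendsto_sum) auto
    then have S: "((\<lambda>y. \<Sum>i\<in>{1..num_edges N}. ?l i x y) \<longlongrightarrow> 0) (at x within {0..edge_len N})"
      by simp
    have "((\<lambda>y. L2_set (\<lambda>i. ?l i x y) {1..num_edges N}) \<longlongrightarrow> 0) (at x within {0..edge_len N})"
      by (rule tendsto_sandwich[OF _ _ tendsto_const S])
        (auto intro!: always_eventually L2_set_le_sum)
    then show ?L by (simp add: slice_norm_eq)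
  qed
  then show ?thesis
    unfolding state_space_def by auto
qed

lemma state_space_diff:
  assumes z: "z \<in> state_space N" and w: "w \<in> state_space N"
  shows "(\<lambda>s. z s - w s) \<in> state_space N"
  unfolding state_space_iff
proof (intro ballI conjI)
  fix x i assume x: "x \<in> {0..edge_len N}" and i: "i \<in> {1..num_edges N}"
  let ?T = "horizon N"
  have zL: "(\<lambda>t. z (i, t, y)) \<in> L2 ?T" and wL: "(\<lambda>t. w (i, t, y)) \<in> L2 ?T" if "y \<in> {0..edge_len N}" for y
    using z w i that by (auto simp: state_space_iff)
  show "(\<lambda>t. z (i, t, x) - w (i, t, x)) \<in> L2 ?T"
    using zL wL x by (intro L2_diff)
  let ?b = "\<lambda>y. L2_norm ?T (\<lambda>t. z (i, t, y) - z (i, t, x)) + L2_norm ?T (\<lambda>t. w (i, t, y) - w (i, t, x))"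
  have "(?b \<longlongrightarrow> 0 + 0) (at x within {0..edge_len N})"
    using z w x i by (intro tendsto_add) (auto simp: state_space_iff)
  then have b: "(?b \<longlongrightarrow> 0) (at x within {0..edge_len N})" by simp
  show "((\<lambda>y. L2_norm ?T (\<lambda>t. z (i, t, y) - w (i, t, y) - (z (i, t, x) - w (i, t, x)))) \<longlongrightarrow> 0)
    (at x within {0..edge_len N})"
  proof (rule tendsto_sandwich[OF _ _ tendsto_const b])
    show "\<forall>\<^sub>F y in at x within {0..edge_len N}.
      L2_norm ?T (\<lambda>t. z (i, t, y) - w (i, t, y) - (z (i, t, x) - w (i, t, x))) \<le> ?b y"
      unfolding eventually_at_filter
    proof (intro always_eventually allI impI)
      fix y assume "y \<in> {0..edge_len N}"
      then have "(\<lambda>t. z (i, t, y) - z (i, t, x)) \<in> L2 ?T" "(\<lambda>t. w (i, t, x) - w (i, t, y)) \<in> L2 ?T"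
        using zL wL x by (auto intro!: L2_diff)
      from L2_norm_triangle[OF this]
      show "L2_norm ?T (\<lambda>t. z (i, t, y) - w (i, t, y) - (z (i, t, x) - w (i, t, x))) \<le> ?b y"
        using L2_norm_minus_commute[of ?T "\<lambda>t. w (i, t, x)" "\<lambda>t. w (i, t, y)"]
        by (simp add: algebra_simps)
    qed
  qed simp
qed

lemma shift_cmult: "shift a (\<lambda>t. r * u t) t = r * shift a u t"
  by (simp add: shift_def)

context transport_network
begin

definition transport :: "(real \<Rightarrow> real) \<Rightarrow> state" where
  "transport u = (\<lambda>(k, t, x). c k * shift (d k + x / velocity N k) u t)"

lemma d_nonneg:
  assumes "k \<in> {1..num_edges N}"
  shows "0 \<le> d k"
  using N assms
proof (induction rule: network_induct)
  case (inner i k)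
  then show ?case
    using network_positive[OF N] inner_vertex_range[OF N]
    by (subst d_inner[of i]) (auto intro!: add_nonneg_nonneg divide_nonneg_pos simp: less_imp_le)
qed (simp add: d_source[simplified])

lemma delay_nonneg: "k \<in> {1..num_edges N} \<Longrightarrow> 0 \<le> x \<Longrightarrow> 0 \<le> d k + x / velocity N k"
  using d_nonneg network_positive[OF N] by (intro add_nonneg_nonneg divide_nonneg_pos) auto

lemma transport_L2:
  assumes "u \<in> L2 (horizon N)" "k \<in> {1..num_edges N}" "0 \<le> x"
  shows "(\<lambda>t. transport u (k, t, x)) \<in> L2 (horizon N)"
    "L2_norm (horizon N) (\<lambda>t. transport u (k, t, x)) \<le> \<bar>c k\<bar> * L2_norm (horizon N) u"
  using shift_in_L2[OF assms(1) delay_nonneg[OF assms(2,3)]]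
    L2_norm_shift_le[OF assms(1) delay_nonneg[OF assms(2,3)]]
  by (auto simp: transport_def L2_norm_cmult intro!: L2_cmult mult_left_mono)

lemma transport_in_state_space:
  assumes u: "u \<in> L2 (horizon N)"
  shows "transport u \<in> state_space N"
  unfolding state_space_iff
proof (intro ballI conjI)
  fix x i assume x: "x \<in> {0..edge_len N}" and i: "i \<in> {1..num_edges N}"
  let ?X = "at x within {0..edge_len N}"
  have v: "0 < velocity N i" using i by (rule network_positive[OF N])
  show "(\<lambda>t. transport u (i, t, x)) \<in> L2 (horizon N)"
    using u i x by (intro transport_L2) auto
  let ?f = "\<lambda>x. d i + x / velocity N i"
  have "(?f \<longlongrightarrow> ?f x) ?X"
    using v by (intro tendsto_intros) simp
  \<comment> \<open>The punctured filter also demands that the delay differ from its limit; it does,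
    being strictly increasing in the position.\<close>
  moreover have "\<forall>\<^sub>F y in ?X. ?f y \<in> {0..} \<and> ?f y \<noteq> ?f x"
    unfolding eventually_at_filter using v delay_nonneg[OF i] by (intro always_eventually) simp
  ultimately have "filterlim ?f (at (?f x) within {0..}) ?X"
    unfolding filterlim_at by simp
  from filterlim_compose[OF shift_continuous[OF u delay_nonneg[OF i]] this]
  have "((\<lambda>y. L2_norm (horizon N) (\<lambda>t. shift (?f y) u t - shift (?f x) u t)) \<longlongrightarrow> 0) ?X"
    using x by simp
  from tendsto_mult_right_zero[OF this, of "\<bar>c i\<bar>"]
  show "((\<lambda>y. L2_norm (horizon N) (\<lambda>t. transport u (i, t, y) - transport u (i, t, x))) \<longlongrightarrow> 0) ?X"
    by (simp add: transport_def right_diff_distrib[symmetric] L2_norm_cmult)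
qed

lemma transport_source: "transport u (1, t, x) =
    (if t - x / velocity N 1 > 0 then 1 / velocity N 1 * u (t - x / velocity N 1) else 0)"
  by (simp add: transport_def c_source[simplified] d_source[simplified] shift_def)

text \<open>Delays compose: the travel time up to the end of edge \<open>i\<close> is the delay
  \<open>d k\<close> at the start of edge \<open>k\<close>, and the scalings multiply
  accordingly.\<close>

lemma transport_inner:
  assumes "i \<in> inner_vertices N" "(i, k) \<in> parcs (net_graph N)" "0 \<le> x"
  shows "transport u (k, t, x) = ratio N i k * (velocity N i / velocity N k) *
    shift (x / velocity N k) (\<lambda>t. transport u (i, t, edge_len N)) t"
proof -
  have i: "i \<in> {1..num_edges N}" using assms(1) by (rule inner_vertex_range[OF N])
  have "0 \<le> x / velocity N k"
    using assms arc_in_range[OF N] network_positive[OF N] by (intro divide_nonneg_pos) auto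
  moreover have "0 \<le> d i + edge_len N / velocity N i"
    using i network_positive[OF N] by (intro delay_nonneg) auto
  ultimately show ?thesis
    using c_inner[OF assms(1,2)] d_inner[OF assms(1,2)]
    by (simp add: transport_def shift_cmult shift_shift ac_simps)
qed

lemma transport_solves: "solves_network N u (transport u)"
  unfolding solves_network_def transport_source
  by (auto simp: transport_inner shift_def)

text \<open>The trace of the preceding edge at its end determines the next edge, and delays preserve
  almost everywhere equality. The position is generalized because the induction hypothesis is used
  at \<open>edge_len N\<close>.\<close>

lemma solution_unique:
  assumes z: "solves_network N u z" and k: "k \<in> {1..num_edges N}" and x: "x \<in> {0..edge_len N}"
  shows "AE t in lebesgue_on {0<..<horizon N}. z (k, t, x) = transport u (k, t, x)"
  using N k x
proof (induction arbitrary: x rule: network_induct)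
  case source
  then show ?case
    using z unfolding transport_source solves_network_def by blast
next
  case (inner i k)
  let ?M = "lebesgue_on {0<..<horizon N}"
  have "edge_len N \<in> {0..edge_len N}" using network_positive[OF N] by simp
  from inner.IH[OF this]
  have "AE t in ?M. shift (x / velocity N k) (\<lambda>t. z (i, t, edge_len N)) t =
      shift (x / velocity N k) (\<lambda>t. transport u (i, t, edge_len N)) t"
    using inner.prems inner.hyps arc_in_range[OF N] network_positive[OF N]
    by (intro shift_cong_AE divide_nonneg_pos) auto
  moreover have "AE t in ?M. z (k, t, x) = (if t - x / velocity N k > 0
     then ratio N i k * (velocity N i / velocity N k) * z (i, t - x / velocity N k, edge_len N) else 0)"
    using z inner.prems inner.hyps unfolding solves_network_def by blast
  ultimately show ?case
  proof eventually_elim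
    case (elim t)
    then show ?case
      using inner.prems by (subst transport_inner[OF inner.hyps(1,2)]) (auto simp: shift_def)
  qed
qed

lemma sol_op_spec:
  assumes "u \<in> L2 (horizon N)"
  shows "sol_op N u \<in> state_space N" "solves_network N u (sol_op N u)"
  using someI[of "\<lambda>z. z \<in> state_space N \<and> solves_network N u z" "transport u"]
    transport_in_state_space[OF assms] transport_solves unfolding sol_op_def by blast+

lemma sol_op_AE:
  assumes "u \<in> L2 (horizon N)" "k \<in> {1..num_edges N}" "x \<in> {0..edge_len N}"
  shows "AE t in lebesgue_on {0<..<horizon N}. sol_op N u (k, t, x) = transport u (k, t, x)"
  by (rule solution_unique[OF sol_op_spec(2)[OF assms(1)] assms(2,3)])

end

section \<open>The lower-level problem\<close>

lemma L2_midpoint: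
  assumes "u \<in> L2 T" "v \<in> L2 T"
  shows "(L2_norm T (\<lambda>t. 1 / 2 * u t + 1 / 2 * v t))\<^sup>2 =
    1 / 2 * (L2_norm T u)\<^sup>2 + 1 / 2 * (L2_norm T v)\<^sup>2 - 1 / 4 * (L2_norm T (\<lambda>t. u t - v t))\<^sup>2"
  using L2_norm_squared_lincomb[OF assms, of "1 / 2" "1 / 2"] L2_norm_squared_lincomb[OF assms, of 1 "- 1"]
  by (simp add: power2_eq_square field_simps)

lemma L2_norm_squared_diff:
  assumes "u \<in> L2 T" "v \<in> L2 T"
  shows "(L2_norm T (\<lambda>t. u t - v t))\<^sup>2 =
    (L2_norm T u)\<^sup>2 - 2 * (\<integral>t. u t * v t \<partial>lebesgue_on {0<..<T}) + (L2_norm T v)\<^sup>2"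
  using L2_norm_squared_lincomb[OF assms, of 1 "- 1"] by simp

text \<open>The left side equals twice the inner product of \<open>p - q\<close> and
  \<open>a - b\<close>: every pure square occurs once with each sign. It will be used with two
  outflows and two targets.\<close>

lemma L2_four_points:
  assumes p: "p \<in> L2 T" and q: "q \<in> L2 T" and a: "a \<in> L2 T" and b: "b \<in> L2 T"
  shows "(L2_norm T (\<lambda>t. q t - a t))\<^sup>2 - (L2_norm T (\<lambda>t. p t - a t))\<^sup>2 +
      (L2_norm T (\<lambda>t. p t - b t))\<^sup>2 - (L2_norm T (\<lambda>t. q t - b t))\<^sup>2
    \<le> 2 * (L2_norm T (\<lambda>t. p t - q t) * L2_norm T (\<lambda>t. a t - b t))"
proof -
  let ?M = "lebesgue_on {0<..<T}"
  have "(\<integral>t. (p t - q t) * (a t - b t) \<partial>?M) =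
    (\<integral>t. p t * a t \<partial>?M) - (\<integral>t. p t * b t \<partial>?M) - (\<integral>t. q t * a t \<partial>?M) + (\<integral>t. q t * b t \<partial>?M)"
    using L2_mult_integrable[OF p a] L2_mult_integrable[OF p b] L2_mult_integrable[OF q a]
      L2_mult_integrable[OF q b]
    by (simp add: algebra_simps)
  moreover have "(\<integral>t. (p t - q t) * (a t - b t) \<partial>?M) \<le> L2_norm T (\<lambda>t. p t - q t) * L2_norm T (\<lambda>t. a t - b t)"
    using L2_Cauchy_Schwarz[OF L2_diff[OF p q] L2_diff[OF a b]] by simp
  ultimately show ?thesis
    using assms by (simp add: L2_norm_squared_diff)
qed

lemma L2_norm_tendsto:
  assumes "\<And>n. u n \<in> L2 T" "v \<in> L2 T" and lim: "(\<lambda>n. L2_norm T (\<lambda>t. u n t - v t)) \<longlonglongrightarrow> 0"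
  shows "(\<lambda>n. L2_norm T (u n)) \<longlonglongrightarrow> L2_norm T v"
proof -
  have "(\<lambda>n. L2_norm T (u n) - L2_norm T v) \<longlonglongrightarrow> 0"
    using L2_norm_diff_ineq assms(1,2) by (intro Lim_null_comparison[OF _ lim] always_eventually) auto
  then show ?thesis by (rule LIM_zero_cancel)
qed

text \<open>By uniform convexity, a minimizing sequence is a Cauchy sequence.\<close>

lemma L2_minimizer_exists:
  assumes A: "A \<subseteq> L2 T" "A \<noteq> {}"
    and convex: "\<And>u v. u \<in> A \<Longrightarrow> v \<in> A \<Longrightarrow> (\<lambda>t. 1 / 2 * u t + 1 / 2 * v t) \<in> A"
    and closed: "\<And>u v. (\<And>n. u n \<in> A) \<Longrightarrow> v \<in> L2 T \<Longrightarrow>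
      AE t in lebesgue_on {0<..<T}. (\<lambda>n. u n t) \<longlonglongrightarrow> v t \<Longrightarrow> v \<in> A"
    and bound: "\<And>u. u \<in> A \<Longrightarrow> 0 \<le> J u"
    and "0 < \<kappa>"
    and mid: "\<And>u v. u \<in> A \<Longrightarrow> v \<in> A \<Longrightarrow> J (\<lambda>t. 1 / 2 * u t + 1 / 2 * v t) +
      \<kappa> * (L2_norm T (\<lambda>t. u t - v t))\<^sup>2 \<le> 1 / 2 * J u + 1 / 2 * J v"
    and cont: "\<And>u v. (\<And>n. u n \<in> L2 T) \<Longrightarrow> v \<in> L2 T \<Longrightarrow>
      (\<lambda>n. L2_norm T (\<lambda>t. u n t - v t)) \<longlonglongrightarrow> 0 \<Longrightarrow> (\<lambda>n. J (u n)) \<longlonglongrightarrow> J v"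
  shows "\<exists>u. is_arg_min J (\<lambda>u. u \<in> A) u"
proof -
  define m where "m = Inf (J ` A)"
  have bdd: "bdd_below (J ` A)"
    using bound by (intro bdd_belowI[of _ 0]) auto
  have m_le: "m \<le> J u" if "u \<in> A" for u
    unfolding m_def using bdd that by (intro cInf_lower) auto
  have "\<exists>u\<in>A. J u < m + 1 / real (Suc n)" for n
    using cInf_lessD[of "J ` A" "m + 1 / real (Suc n)"] A(2) by (auto simp: m_def)
  then obtain u where u: "\<And>n. u n \<in> A" and less: "\<And>n. J (u n) < m + 1 / real (Suc n)"
    by metis
  \<comment> \<open>Both values exceed the infimum \<open>m\<close> by at most
    \<open>1 / real (Suc K)\<close>, while the value at the midpoint is at least \<open>m\<close>;
    the convexity gap absorbs the difference.\<close>
  have dist: "\<kappa> * (L2_norm T (\<lambda>t. u j t - u k t))\<^sup>2 \<le> 1 / real (Suc K)" if "K \<le> j" "K \<le> k" for j k K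
  proof -
    have "1 / real (Suc j) \<le> 1 / real (Suc K)" "1 / real (Suc k) \<le> 1 / real (Suc K)"
      using that by (auto intro!: divide_left_mono)
    then show ?thesis
      using mid[OF u u, of j k] m_le[OF convex[OF u u], of j k] less[of j] less[of k] by linarith
  qed
  obtain v r where v: "v \<in> L2 T" and "strict_mono r"
    and ae: "AE t in lebesgue_on {0<..<T}. (\<lambda>k. u (r k) t) \<longlonglongrightarrow> v t"
    and lim: "(\<lambda>n. L2_norm T (\<lambda>t. u n t - v t)) \<longlonglongrightarrow> 0"
  proof (rule L2_complete)
    show "u n \<in> L2 T" for n using u A by auto
    fix e :: real assume "0 < e"
    then obtain K :: nat where "1 / real (Suc K) < \<kappa> * e\<^sup>2"
      using reals_Archimedean[of "\<kappa> * e\<^sup>2"] \<open>0 < \<kappa>\<close> by (auto simp: inverse_eq_divide)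
    have "L2_norm T (\<lambda>t. u j t - u k t) < e" if "K \<le> j" "K \<le> k" for j k
    proof -
      have "\<kappa> * (L2_norm T (\<lambda>t. u j t - u k t))\<^sup>2 < \<kappa> * e\<^sup>2"
        using dist[OF that] \<open>1 / real (Suc K) < \<kappa> * e\<^sup>2\<close> by linarith
      then show ?thesis
        using \<open>0 < \<kappa>\<close> \<open>0 < e\<close> by (intro power2_less_imp_less[of _ e]) auto
    qed
    then show "\<exists>K. \<forall>m\<ge>K. \<forall>n\<ge>K. L2_norm T (\<lambda>t. u m t - u n t) < e" by blast
  qed
  \<comment> \<open>Membership uses the almost everywhere convergent subsequence, the value at the
    limit uses norm convergence of the full sequence.\<close>
  have "v \<in> A"
    using closed[of "\<lambda>k. u (r k)" v] u v ae by simp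
  have "J v \<le> m"
  proof (rule LIMSEQ_le)
    show "(\<lambda>n. J (u n)) \<longlonglongrightarrow> J v"
      using u A v lim by (intro cont) auto
    show "(\<lambda>n. m + 1 / real (Suc n)) \<longlonglongrightarrow> m"
      using tendsto_add[OF tendsto_const[of m] LIMSEQ_inverse_real_of_nat] by (simp add: inverse_eq_divide)
    show "\<exists>K. \<forall>n\<ge>K. J (u n) \<le> m + 1 / real (Suc n)"
      using less by (auto intro: less_imp_le)
  qed
  then have "is_arg_min J (\<lambda>u. u \<in> A) v"
    using \<open>v \<in> A\<close> m_le unfolding is_arg_min_def by fastforce
  then show ?thesis by (rule exI[of _ v])
qed

lemma admissible_subset: "admissible T ua ub \<subseteq> L2 T"
  by (auto simp: admissible_def)

lemma admissible_midpoint: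
  assumes "u \<in> admissible T ua ub" "v \<in> admissible T ua ub"
  shows "(\<lambda>t. 1 / 2 * u t + 1 / 2 * v t) \<in> admissible T ua ub"
proof -
  have u: "AE t in lebesgue_on {0<..<T}. ua t \<le> ereal (u t) \<and> ereal (u t) \<le> ub t"
    and v: "AE t in lebesgue_on {0<..<T}. ua t \<le> ereal (v t) \<and> ereal (v t) \<le> ub t"
    using assms by (auto simp: admissible_def)
  have "AE t in lebesgue_on {0<..<T}. ua t \<le> ereal (1 / 2 * u t + 1 / 2 * v t) \<and>
    ereal (1 / 2 * u t + 1 / 2 * v t) \<le> ub t"
    using u v
  proof eventually_elim
    case (elim t)
    \<comment> \<open>Comparing with the minimum and maximum avoids arithmetic with possibly
      infinite bounds.\<close>
    have "ereal (min (u t) (v t)) \<le> ereal (1 / 2 * u t + 1 / 2 * v t)"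
      "ereal (1 / 2 * u t + 1 / 2 * v t) \<le> ereal (max (u t) (v t))"
      by (auto simp: min_def max_def)
    moreover have "ua t \<le> ereal (min (u t) (v t))" "ereal (max (u t) (v t)) \<le> ub t"
      using elim by (auto simp: min_def max_def)
    ultimately show ?case by (blast intro: order_trans)
  qed
  moreover have "(\<lambda>t. 1 / 2 * u t + 1 / 2 * v t) \<in> L2 T"
    using assms by (intro L2_lincomb) (auto simp: admissible_def)
  ultimately show ?thesis
    unfolding admissible_def by blast
qed

text \<open>Countably many exceptional sets unite to a null set, and non-strict inequalities between
  extended reals pass to limits.\<close>

lemma admissible_closed:
  assumes u: "\<And>n. u n \<in> admissible T ua ub" and "v \<in> L2 T"
    and lim: "AE t in lebesgue_on {0<..<T}. (\<lambda>n. u n t) \<longlonglongrightarrow> v t"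
  shows "v \<in> admissible T ua ub"
proof -
  have "AE t in lebesgue_on {0<..<T}. \<forall>n. ua t \<le> ereal (u n t) \<and> ereal (u n t) \<le> ub t"
    using u by (subst AE_all_countable) (auto simp: admissible_def)
  with lim have "AE t in lebesgue_on {0<..<T}. ua t \<le> ereal (v t) \<and> ereal (v t) \<le> ub t"
  proof eventually_elim
    case (elim t)
    then have "(\<lambda>n. ereal (u n t)) \<longlonglongrightarrow> ereal (v t)"
      by (intro tendsto_ereal)
    with elim show ?case
      by (blast intro: LIMSEQ_le_const LIMSEQ_le_const2)
  qed
  with \<open>v \<in> L2 T\<close> show ?thesis by (auto simp: admissible_def)
qed

context transport_network
begin

lemma transport_lincomb:
  "transport (\<lambda>t. a * u t + b * v t) s = a * transport u s + b * transport v s"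
  by (cases s) (simp add: transport_def shift_def algebra_simps)

lemma transport_diff: "transport (\<lambda>t. u t - v t) s = transport u s - transport v s"
  using transport_lincomb[of 1 u "- 1" v s] by simp

lemma sol_op_L2:
  "u \<in> L2 (horizon N) \<Longrightarrow> k \<in> {1..num_edges N} \<Longrightarrow> x \<in> {0..edge_len N} \<Longrightarrow>
    (\<lambda>t. sol_op N u (k, t, x)) \<in> L2 (horizon N)"
  using sol_op_spec(1) by (auto simp: state_space_iff)

text \<open>Representatives are chosen separately for each control, so linearity is inherited from
  \<open>transport\<close> only up to null sets.\<close>

lemma sol_op_lincomb_AE:
  assumes u: "u \<in> L2 (horizon N)" and v: "v \<in> L2 (horizon N)"
    and k: "k \<in> {1..num_edges N}" and x: "x \<in> {0..edge_len N}"
  shows "AE t in lebesgue_on {0<..<horizon N}. sol_op N (\<lambda>t. a * u t + b * v t) (k, t, x) =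
    a * sol_op N u (k, t, x) + b * sol_op N v (k, t, x)"
  using sol_op_AE[OF L2_lincomb[OF u v, of a b] k x] sol_op_AE[OF u k x] sol_op_AE[OF v k x]
  by eventually_elim (simp add: transport_lincomb)

lemma sol_op_diff_norm:
  assumes u: "u \<in> L2 (horizon N)" and v: "v \<in> L2 (horizon N)"
    and k: "k \<in> {1..num_edges N}" and x: "x \<in> {0..edge_len N}"
  shows "L2_norm (horizon N) (\<lambda>t. sol_op N u (k, t, x) - sol_op N v (k, t, x))
    \<le> \<bar>c k\<bar> * L2_norm (horizon N) (\<lambda>t. u t - v t)"
proof -
  have "AE t in lebesgue_on {0<..<horizon N}.
      sol_op N u (k, t, x) - sol_op N v (k, t, x) = transport (\<lambda>t. u t - v t) (k, t, x)"
    using sol_op_AE[OF u k x] sol_op_AE[OF v k x] by eventually_elim (simp add: transport_diff)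
  then have "L2_norm (horizon N) (\<lambda>t. sol_op N u (k, t, x) - sol_op N v (k, t, x)) =
      L2_norm (horizon N) (\<lambda>t. transport (\<lambda>t. u t - v t) (k, t, x))"
    using u v k x by (intro L2_norm_cong_AE L2_diff sol_op_L2 transport_L2(1)) auto
  also have "\<dots> \<le> \<bar>c k\<bar> * L2_norm (horizon N) (\<lambda>t. u t - v t)"
    using u v k x by (intro transport_L2(2) L2_diff) auto
  finally show ?thesis .
qed

text \<open>One crude constant for two purposes: it bounds each single edge, hence every outflow,
  and also the sum over edges that dominates the slice norm.\<close>

definition gain :: real where
  "gain = (\<Sum>k=1..num_edges N. \<bar>c k\<bar>)"

lemma gain_ge: "k \<in> {1..num_edges N} \<Longrightarrow> \<bar>c k\<bar> \<le> gain"
  unfolding gain_def by (rule member_le_sum) auto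

lemma gain_nonneg: "0 \<le> gain"
  unfolding gain_def by (intro sum_nonneg) auto

text \<open>The sign has to be proved: a real supremum is informative only for sets bounded above,
  so the slice bound comes before the comparison with the slice at position 0.\<close>

lemma state_norm_sol_op_diff:
  assumes u: "u \<in> L2 (horizon N)" and v: "v \<in> L2 (horizon N)"
  shows "0 \<le> state_norm N (\<lambda>s. sol_op N u s - sol_op N v s)"
    "state_norm N (\<lambda>s. sol_op N u s - sol_op N v s) \<le> gain * L2_norm (horizon N) (\<lambda>t. u t - v t)"
proof -
  let ?s = "slice_norm N (\<lambda>s. sol_op N u s - sol_op N v s)"
  have zero: "0 \<in> {0..edge_len N}"
    using network_positive[OF N] by simp
  have le: "?s x \<le> gain * L2_norm (horizon N) (\<lambda>t. u t - v t)" if x: "x \<in> {0..edge_len N}" for x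
  proof -
    have "?s x \<le> (\<Sum>k\<in>{1..num_edges N}. L2_norm (horizon N) (\<lambda>t. sol_op N u (k, t, x) - sol_op N v (k, t, x)))"
      unfolding slice_norm_eq by (rule L2_set_le_sum) simp
    also have "\<dots> \<le> (\<Sum>k\<in>{1..num_edges N}. \<bar>c k\<bar> * L2_norm (horizon N) (\<lambda>t. u t - v t))"
      using sol_op_diff_norm[OF u v _ x] by (intro sum_mono)
    finally show ?thesis by (simp add: gain_def sum_distrib_right)
  qed
  then show "state_norm N (\<lambda>s. sol_op N u s - sol_op N v s) \<le> gain * L2_norm (horizon N) (\<lambda>t. u t - v t)"
    unfolding state_norm_def using zero by (intro cSUP_least) auto
  have "0 \<le> ?s 0"
    unfolding slice_norm_eq by (rule L2_set_nonneg)
  also have "?s 0 \<le> state_norm N (\<lambda>s. sol_op N u s - sol_op N v s)"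
    unfolding state_norm_def using le zero by (intro cSUP_upper bdd_aboveI2) auto
  finally show "0 \<le> state_norm N (\<lambda>s. sol_op N u s - sol_op N v s)" .
qed

lemma edge_len_mem: "edge_len N \<in> {0..edge_len N}"
  using network_positive[OF N] by simp

lemma outflow_L2:
  assumes "u \<in> L2 (horizon N)" "i \<in> demand_vertices N"
  shows "outflow N i u \<in> L2 (horizon N)"
  unfolding outflow_def using assms(1) demand_vertex_range[OF N assms(2)] edge_len_mem by (rule sol_op_L2)

lemma outflow_diff_norm:
  assumes u: "u \<in> L2 (horizon N)" and v: "v \<in> L2 (horizon N)" and i: "i \<in> demand_vertices N"
  shows "L2_norm (horizon N) (\<lambda>t. outflow N i u t - outflow N i v t)
    \<le> gain * L2_norm (horizon N) (\<lambda>t. u t - v t)"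
  unfolding outflow_def using demand_vertex_range[OF N i]
  by (intro order_trans[OF sol_op_diff_norm[OF u v _ edge_len_mem] mult_right_mono] gain_ge) auto

end

section \<open>Uniform convexity of the lower-level problem and stability of its minimizer\<close>

locale lower_level = transport_network N c d
  for N :: network and c d :: "nat \<Rightarrow> real" +
  fixes D :: "nat \<Rightarrow> 'm::finite \<Rightarrow> real \<Rightarrow> real" and \<sigma> :: real and ua ub :: "real \<Rightarrow> ereal"
  assumes D: "i \<in> demand_vertices N \<Longrightarrow> D i l \<in> L2 (horizon N)"
    and \<sigma>_pos: "0 < \<sigma>"
    and admissible_nonempty: "admissible (horizon N) ua ub \<noteq> {}"
begin

abbreviation "J u \<beta> \<equiv> lower_objective N D \<sigma> u \<beta>"

definition target :: "(nat \<Rightarrow> real ^ 'm) \<Rightarrow> nat \<Rightarrow> real \<Rightarrow> real" where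
  "target \<beta> i t = (\<Sum>l\<in>UNIV. \<beta> i $ l * D i l t)"

lemma target_L2: "i \<in> demand_vertices N \<Longrightarrow> target \<beta> i \<in> L2 (horizon N)"
  unfolding target_def using D by (intro L2_sum L2_cmult)

lemma residual_L2:
  "u \<in> L2 (horizon N) \<Longrightarrow> i \<in> demand_vertices N \<Longrightarrow> (\<lambda>t. outflow N i u t - target \<beta> i t) \<in> L2 (horizon N)"
  by (intro L2_diff outflow_L2 target_L2)

lemma lower_objective_eq:
  "J u \<beta> = 1 / 2 * (\<Sum>i\<in>demand_vertices N. (L2_norm (horizon N) (\<lambda>t. outflow N i u t - target \<beta> i t))\<^sup>2) +
     \<sigma> / 2 * (L2_norm (horizon N) u)\<^sup>2"
  unfolding lower_objective_def target_def ..

lemma lower_objective_nonneg: "0 \<le> J u \<beta>"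
  unfolding lower_objective_eq using \<sigma>_pos by (intro add_nonneg_nonneg mult_nonneg_nonneg sum_nonneg) auto

text \<open>The residuals are affine in the control almost everywhere, so the tracking terms are
  convex. The regularization contributes \<open>\<sigma> / 2\<close> times the \<open>1 / 4\<close>
  of the midpoint identity, hence \<open>\<sigma> / 8\<close>.\<close>

lemma lower_objective_midpoint:
  assumes u: "u \<in> L2 (horizon N)" and v: "v \<in> L2 (horizon N)"
  shows "J (\<lambda>t. 1 / 2 * u t + 1 / 2 * v t) \<beta> + \<sigma> / 8 * (L2_norm (horizon N) (\<lambda>t. u t - v t))\<^sup>2
    \<le> 1 / 2 * J u \<beta> + 1 / 2 * J v \<beta>"
proof -
  let ?R = "\<lambda>i u t. outflow N i u t - target \<beta> i t"
  let ?n = "\<lambda>i u. (L2_norm (horizon N) (?R i u))\<^sup>2"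
  let ?w = "\<lambda>t. 1 / 2 * u t + 1 / 2 * v t"
  have "?n i ?w \<le> 1 / 2 * ?n i u + 1 / 2 * ?n i v" if i: "i \<in> demand_vertices N" for i
  proof -
    have "AE t in lebesgue_on {0<..<horizon N}. ?R i ?w t = 1 / 2 * ?R i u t + 1 / 2 * ?R i v t"
      using sol_op_lincomb_AE[OF u v demand_vertex_range[OF N i] edge_len_mem, of "1 / 2" "1 / 2"]
      by eventually_elim (simp add: outflow_def field_simps)
    then have "L2_norm (horizon N) (?R i ?w) = L2_norm (horizon N) (\<lambda>t. 1 / 2 * ?R i u t + 1 / 2 * ?R i v t)"
      using u v i by (intro L2_norm_cong_AE residual_L2 L2_lincomb)
    then show ?thesis
      using L2_midpoint[OF residual_L2[OF u i, of \<beta>] residual_L2[OF v i, of \<beta>]] by simp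
  qed
  then have "(\<Sum>i\<in>demand_vertices N. ?n i ?w) \<le> (\<Sum>i\<in>demand_vertices N. 1 / 2 * ?n i u + 1 / 2 * ?n i v)"
    by (rule sum_mono)
  also have "\<dots> = 1 / 2 * (\<Sum>i\<in>demand_vertices N. ?n i u) + 1 / 2 * (\<Sum>i\<in>demand_vertices N. ?n i v)"
    by (simp add: sum.distrib sum_distrib_left)
  finally have "(\<Sum>i\<in>demand_vertices N. ?n i ?w) \<le>
    1 / 2 * (\<Sum>i\<in>demand_vertices N. ?n i u) + 1 / 2 * (\<Sum>i\<in>demand_vertices N. ?n i v)" .
  then show ?thesis
    unfolding lower_objective_eq L2_midpoint[OF u v] by (simp add: algebra_simps)
qed

lemma lower_objective_continuous:
  assumes u: "\<And>n. u n \<in> L2 (horizon N)" and v: "v \<in> L2 (horizon N)"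
    and lim: "(\<lambda>n. L2_norm (horizon N) (\<lambda>t. u n t - v t)) \<longlonglongrightarrow> 0"
  shows "(\<lambda>n. J (u n) \<beta>) \<longlonglongrightarrow> J v \<beta>"
  unfolding lower_objective_eq
proof (intro tendsto_intros)
  show "(\<lambda>n. L2_norm (horizon N) (u n)) \<longlonglongrightarrow> L2_norm (horizon N) v"
    using u v lim by (rule L2_norm_tendsto)
next
  fix i assume i: "i \<in> demand_vertices N"
  show "(\<lambda>n. L2_norm (horizon N) (\<lambda>t. outflow N i (u n) t - target \<beta> i t))
    \<longlonglongrightarrow> L2_norm (horizon N) (\<lambda>t. outflow N i v t - target \<beta> i t)"
  proof (rule L2_norm_tendsto)
    have "(\<lambda>n. L2_norm (horizon N) (\<lambda>t. outflow N i (u n) t - outflow N i v t)) \<longlonglongrightarrow> 0"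
      using outflow_diff_norm[OF u v i]
      by (intro Lim_null_comparison[OF _ tendsto_mult_right_zero[OF lim, of gain]] always_eventually) auto
    then show "(\<lambda>n. L2_norm (horizon N) (\<lambda>t. outflow N i (u n) t - target \<beta> i t - (outflow N i v t - target \<beta> i t)))
      \<longlonglongrightarrow> 0"
      by simp
  qed (use u v i in \<open>auto intro: residual_L2\<close>)
qed

text \<open>Existence of a minimizer is what makes the choice behind \<open>arg_min\<close> return
  one.\<close>

lemma Psi_is_arg_min:
  "is_arg_min (\<lambda>u. J u \<beta>) (\<lambda>u. u \<in> admissible (horizon N) ua ub) (Psi N D \<sigma> ua ub \<beta>)"
proof -
  have "\<exists>u. is_arg_min (\<lambda>u. J u \<beta>) (\<lambda>u. u \<in> admissible (horizon N) ua ub) u"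
  proof (rule L2_minimizer_exists[where \<kappa> = "\<sigma> / 8"])
    show "0 < \<sigma> / 8" using \<sigma>_pos by simp
    show "J (\<lambda>t. 1 / 2 * u t + 1 / 2 * v t) \<beta> + \<sigma> / 8 * (L2_norm (horizon N) (\<lambda>t. u t - v t))\<^sup>2
      \<le> 1 / 2 * J u \<beta> + 1 / 2 * J v \<beta>"
      if "u \<in> admissible (horizon N) ua ub" "v \<in> admissible (horizon N) ua ub" for u v
      using that admissible_subset by (intro lower_objective_midpoint) auto
    show "(\<lambda>n. J (u n) \<beta>) \<longlonglongrightarrow> J v \<beta>"
      if "\<And>n. u n \<in> L2 (horizon N)" "v \<in> L2 (horizon N)"
        "(\<lambda>n. L2_norm (horizon N) (\<lambda>t. u n t - v t)) \<longlonglongrightarrow> 0" for u v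
      using that by (rule lower_objective_continuous)
    show "v \<in> admissible (horizon N) ua ub"
      if "\<And>n. u n \<in> admissible (horizon N) ua ub" "v \<in> L2 (horizon N)"
        "AE t in lebesgue_on {0<..<horizon N}. (\<lambda>n. u n t) \<longlonglongrightarrow> v t" for u v
      using that by (rule admissible_closed)
  qed (intro admissible_subset admissible_nonempty admissible_midpoint lower_objective_nonneg; assumption)+
  then show ?thesis
    unfolding Psi_def arg_min_def by (rule someI_ex)
qed

lemma Psi_L2: "Psi N D \<sigma> ua ub \<beta> \<in> L2 (horizon N)"
  using Psi_is_arg_min[of \<beta>] admissible_subset by (auto simp: is_arg_min_def)

text \<open>The midpoint is admissible, so its value is at least the minimum; inserting this into
  the midpoint inequality and doubling turns \<open>\<sigma> / 8\<close> into
  \<open>\<sigma> / 4\<close>.\<close>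

lemma quadratic_growth:
  assumes u: "is_arg_min (\<lambda>u. J u \<beta>) (\<lambda>u. u \<in> admissible (horizon N) ua ub) u"
    and v: "v \<in> admissible (horizon N) ua ub"
  shows "J u \<beta> + \<sigma> / 4 * (L2_norm (horizon N) (\<lambda>t. u t - v t))\<^sup>2 \<le> J v \<beta>"
proof -
  have u': "u \<in> admissible (horizon N) ua ub"
    and min: "\<And>w. w \<in> admissible (horizon N) ua ub \<Longrightarrow> J u \<beta> \<le> J w \<beta>"
    using u by (auto simp: is_arg_min_def not_less)
  have "J u \<beta> + \<sigma> / 8 * (L2_norm (horizon N) (\<lambda>t. u t - v t))\<^sup>2 \<le> 1 / 2 * J u \<beta> + 1 / 2 * J v \<beta>"
    using min[OF admissible_midpoint[OF u' v]] u' v admissible_subset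
      lower_objective_midpoint[of u v \<beta>] by fastforce
  then show ?thesis by simp
qed

theorem Psi_Lipschitz:
  "\<sigma> * L2_norm (horizon N) (\<lambda>t. Psi N D \<sigma> ua ub \<beta> t - Psi N D \<sigma> ua ub \<gamma> t)
    \<le> 2 * gain * (\<Sum>i\<in>demand_vertices N. \<Sum>l\<in>UNIV. \<bar>\<beta> i $ l - \<gamma> i $ l\<bar> * L2_norm (horizon N) (D i l))"
proof -
  let ?T = "horizon N"
  define u where "u = Psi N D \<sigma> ua ub \<beta>"
  define v where "v = Psi N D \<sigma> ua ub \<gamma>"
  have u: "u \<in> L2 ?T" and v: "v \<in> L2 ?T"
    by (simp_all add: u_def v_def Psi_L2)
  let ?d = "L2_norm ?T (\<lambda>t. u t - v t)"
  let ?e = "\<lambda>i. \<Sum>l\<in>UNIV. \<bar>\<beta> i $ l - \<gamma> i $ l\<bar> * L2_norm ?T (D i l)"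
  have target: "L2_norm ?T (\<lambda>t. target \<beta> i t - target \<gamma> i t) \<le> ?e i" if i: "i \<in> demand_vertices N" for i
  proof -
    have "L2_norm ?T (\<lambda>t. target \<beta> i t - target \<gamma> i t) = L2_norm ?T (\<lambda>t. \<Sum>l\<in>UNIV. (\<beta> i $ l - \<gamma> i $ l) * D i l t)"
      by (simp add: target_def sum_subtractf left_diff_distrib)
    also have "\<dots> \<le> (\<Sum>l\<in>UNIV. L2_norm ?T (\<lambda>t. (\<beta> i $ l - \<gamma> i $ l) * D i l t))"
      using D[OF i] by (intro L2_norm_sum_le L2_cmult) auto
    finally show ?thesis by (simp add: L2_norm_cmult)
  qed
  have "\<sigma> / 4 * ?d\<^sup>2 \<le> J v \<beta> - J u \<beta>"
    using quadratic_growth[OF Psi_is_arg_min[of \<beta>], of v] Psi_is_arg_min[of \<gamma>]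
    by (simp add: u_def v_def is_arg_min_def)
  moreover have "\<sigma> / 4 * ?d\<^sup>2 \<le> J u \<gamma> - J v \<gamma>"
    using quadratic_growth[OF Psi_is_arg_min[of \<gamma>], of u] Psi_is_arg_min[of \<beta>]
      L2_norm_minus_commute[of ?T u v]
    by (simp add: u_def v_def is_arg_min_def)
  ultimately have "\<sigma> / 2 * ?d\<^sup>2 \<le> J v \<beta> - J u \<beta> + J u \<gamma> - J v \<gamma>" by simp
  \<comment> \<open>The regularization does not depend on the weights, so it cancels between the two
    problems.\<close>
  also have "\<dots> = 1 / 2 * (\<Sum>i\<in>demand_vertices N.
      (L2_norm ?T (\<lambda>t. outflow N i v t - target \<beta> i t))\<^sup>2 - (L2_norm ?T (\<lambda>t. outflow N i u t - target \<beta> i t))\<^sup>2 +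
      (L2_norm ?T (\<lambda>t. outflow N i u t - target \<gamma> i t))\<^sup>2 - (L2_norm ?T (\<lambda>t. outflow N i v t - target \<gamma> i t))\<^sup>2)"
    unfolding lower_objective_eq sum.distrib sum_subtractf by (simp add: algebra_simps)
  also have "\<dots> \<le> 1 / 2 * (\<Sum>i\<in>demand_vertices N. 2 * (gain * ?d * ?e i))"
  proof (intro mult_left_mono sum_mono)
    fix i assume i: "i \<in> demand_vertices N"
    have "(L2_norm ?T (\<lambda>t. outflow N i v t - target \<beta> i t))\<^sup>2 - (L2_norm ?T (\<lambda>t. outflow N i u t - target \<beta> i t))\<^sup>2 +
      (L2_norm ?T (\<lambda>t. outflow N i u t - target \<gamma> i t))\<^sup>2 - (L2_norm ?T (\<lambda>t. outflow N i v t - target \<gamma> i t))\<^sup>2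
      \<le> 2 * (L2_norm ?T (\<lambda>t. outflow N i u t - outflow N i v t) * L2_norm ?T (\<lambda>t. target \<beta> i t - target \<gamma> i t))"
      using u v i by (intro L2_four_points outflow_L2 target_L2)
    also have "\<dots> \<le> 2 * (gain * ?d * ?e i)"
      using outflow_diff_norm[OF u v i] target[OF i] gain_nonneg
      by (intro mult_left_mono mult_mono) auto
    finally show "(L2_norm ?T (\<lambda>t. outflow N i v t - target \<beta> i t))\<^sup>2 - (L2_norm ?T (\<lambda>t. outflow N i u t - target \<beta> i t))\<^sup>2 +
      (L2_norm ?T (\<lambda>t. outflow N i u t - target \<gamma> i t))\<^sup>2 - (L2_norm ?T (\<lambda>t. outflow N i v t - target \<gamma> i t))\<^sup>2
      \<le> 2 * (gain * ?d * ?e i)" .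
  qed simp
  also have "\<dots> = gain * ?d * (\<Sum>i\<in>demand_vertices N. ?e i)"
    by (simp only: sum_distrib_left[symmetric])
  \<comment> \<open>Arranged so that one factor \<open>?d\<close> can be cancelled; if it is zero,
    the claim holds because the right side is nonnegative.\<close>
  finally have "?d * (\<sigma> * ?d) \<le> ?d * (2 * gain * (\<Sum>i\<in>demand_vertices N. ?e i))"
    by (simp add: power2_eq_square ac_simps)
  moreover have "0 \<le> (\<Sum>i\<in>demand_vertices N. ?e i)"
    by (intro sum_nonneg mult_nonneg_nonneg) auto
  ultimately have "\<sigma> * ?d \<le> 2 * gain * (\<Sum>i\<in>demand_vertices N. ?e i)"
    using gain_nonneg by (cases "?d = 0") (auto simp: mult_le_cancel_left order_less_le)
  then show ?thesis by (simp add: u_def v_def)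
qed

lemma Psi_continuous:
  fixes b :: "nat \<Rightarrow> nat \<Rightarrow> real ^ 'm"
  assumes "\<And>i. i \<in> demand_vertices N \<Longrightarrow> (\<lambda>n. b n i) \<longlonglongrightarrow> \<beta> i"
  shows "(\<lambda>n. L2_norm (horizon N) (\<lambda>t. Psi N D \<sigma> ua ub (b n) t - Psi N D \<sigma> ua ub \<beta> t)) \<longlonglongrightarrow> 0"
proof -
  let ?d = "\<lambda>n. L2_norm (horizon N) (\<lambda>t. Psi N D \<sigma> ua ub (b n) t - Psi N D \<sigma> ua ub \<beta> t)"
  let ?b = "\<lambda>n. 2 * gain * (\<Sum>i\<in>demand_vertices N. \<Sum>l\<in>UNIV. \<bar>b n i $ l - \<beta> i $ l\<bar> * L2_norm (horizon N) (D i l)) / \<sigma>"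
  have "?b \<longlonglongrightarrow> 2 * gain * (\<Sum>i\<in>demand_vertices N. \<Sum>l\<in>UNIV. \<bar>\<beta> i $ l - \<beta> i $ l\<bar> * L2_norm (horizon N) (D i l)) / \<sigma>"
    using assms \<sigma>_pos by (intro tendsto_intros) auto
  then have lim: "?b \<longlonglongrightarrow> 0" by simp
  have "?d n \<le> ?b n" for n
    using Psi_Lipschitz[of "b n" \<beta>] \<sigma>_pos by (simp add: pos_le_divide_eq mult.commute)
  then show ?thesis
    by (intro Lim_null_comparison[OF _ lim] always_eventually) auto
qed

end

section \<open>Existence of a globally optimal solution\<close>

lemma bounded_linear_map_diff_bound:
  assumes F: "bounded_linear_map X \<nu> F"
    and diff: "\<And>f g. f \<in> X \<Longrightarrow> g \<in> X \<Longrightarrow> (\<lambda>s. f s - g s) \<in> X"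
  obtains K where "0 \<le> K"
    "\<And>f g. f \<in> X \<Longrightarrow> g \<in> X \<Longrightarrow> 0 \<le> \<nu> (\<lambda>s. f s - g s) \<Longrightarrow> norm (F f - F g) \<le> K * \<nu> (\<lambda>s. f s - g s)"
proof -
  obtain K where K: "\<And>f. f \<in> X \<Longrightarrow> norm (F f) \<le> K * \<nu> f"
    and add: "\<And>f g. f \<in> X \<Longrightarrow> g \<in> X \<Longrightarrow> F (\<lambda>s. f s + g s) = F f + F g"
    using F unfolding bounded_linear_map_def by blast
  have "norm (F f - F g) \<le> \<bar>K\<bar> * \<nu> (\<lambda>s. f s - g s)"
    if "f \<in> X" "g \<in> X" "0 \<le> \<nu> (\<lambda>s. f s - g s)" for f g
  proof -
    \<comment> \<open>Additivity is applied to \<open>f = (f - g) + g\<close>. The given constant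
      \<open>K\<close> may be negative, so it is replaced by its absolute value, at the price of a
      sign condition on the seminorm.\<close>
    have "F f = F (\<lambda>s. f s - g s) + F g"
      using add[OF diff[OF that(1,2)] that(2)] by simp
    then have "norm (F f - F g) \<le> K * \<nu> (\<lambda>s. f s - g s)"
      using K[OF diff[OF that(1,2)]] by simp
    also have "\<dots> \<le> \<bar>K\<bar> * \<nu> (\<lambda>s. f s - g s)"
      using that(3) by (intro mult_right_mono) auto
    finally show ?thesis .
  qed
  then show thesis by (intro that[of "\<bar>K\<bar>"]) auto
qed

lemma tendsto_of_diff_bound:
  fixes f :: "nat \<Rightarrow> 'a::real_normed_vector"
  assumes "\<And>n. norm (f n - l) \<le> g n" "g \<longlonglongrightarrow> 0"
  shows "f \<longlonglongrightarrow> l"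
proof (rule LIM_zero_cancel)
  show "(\<lambda>n. f n - l) \<longlonglongrightarrow> 0"
    by (rule Lim_null_comparison[OF always_eventually assms(2)]) (simp add: assms(1))
qed

text \<open>The observations drop out of differences, so both misfits move by at most a constant
  times the distance of the controls.\<close>

lemma (in transport_network) bilevel_objective_continuous:
  assumes zo: "\<forall>r\<in>{1..p}. zo r \<in> state_space N" and uo: "\<forall>r\<in>{1..p}. uo r \<in> L2 (horizon N)"
    and Cobs: "bounded_linear_map (state_space N) (state_norm N) Cobs"
    and Dobs: "bounded_linear_map (L2 (horizon N)) (L2_norm (horizon N)) Dobs"
    and u: "\<And>n. u n \<in> L2 (horizon N)" and v: "v \<in> L2 (horizon N)"
    and lim: "(\<lambda>n. L2_norm (horizon N) (\<lambda>t. u n t - v t)) \<longlonglongrightarrow> 0"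
  shows "(\<lambda>n. bilevel_objective N p zo uo Cobs Dobs (u n)) \<longlonglongrightarrow> bilevel_objective N p zo uo Cobs Dobs v"
  unfolding bilevel_objective_def
proof (intro tendsto_intros)
  fix r assume r: "r \<in> {1..p}"
  obtain K where "0 \<le> K" and K: "\<And>f g. f \<in> state_space N \<Longrightarrow> g \<in> state_space N \<Longrightarrow>
      0 \<le> state_norm N (\<lambda>s. f s - g s) \<Longrightarrow> norm (Cobs f - Cobs g) \<le> K * state_norm N (\<lambda>s. f s - g s)"
    using bounded_linear_map_diff_bound[OF Cobs state_space_diff] by blast
  have "norm (Cobs (\<lambda>s. sol_op N (u n) s - zo r s) - Cobs (\<lambda>s. sol_op N v s - zo r s))
      \<le> K * (gain * L2_norm (horizon N) (\<lambda>t. u n t - v t))" for n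
  proof -
    have "norm (Cobs (\<lambda>s. sol_op N (u n) s - zo r s) - Cobs (\<lambda>s. sol_op N v s - zo r s))
      \<le> K * state_norm N (\<lambda>s. sol_op N (u n) s - sol_op N v s)"
      using K[of "\<lambda>s. sol_op N (u n) s - zo r s" "\<lambda>s. sol_op N v s - zo r s"]
        state_norm_sol_op_diff(1)[OF u[of n] v] sol_op_spec(1)[OF u] sol_op_spec(1)[OF v] zo r
      by (simp add: state_space_diff)
    also have "\<dots> \<le> K * (gain * L2_norm (horizon N) (\<lambda>t. u n t - v t))"
      using \<open>0 \<le> K\<close> by (intro mult_left_mono state_norm_sol_op_diff(2) u v)
    finally show ?thesis .
  qed
  moreover have "(\<lambda>n. K * (gain * L2_norm (horizon N) (\<lambda>t. u n t - v t))) \<longlonglongrightarrow> 0"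
    by (intro tendsto_mult_right_zero lim)
  ultimately show "(\<lambda>n. Cobs (\<lambda>s. sol_op N (u n) s - zo r s)) \<longlonglongrightarrow> Cobs (\<lambda>s. sol_op N v s - zo r s)"
    by (rule tendsto_of_diff_bound)
  obtain K' where K': "\<And>f g. f \<in> L2 (horizon N) \<Longrightarrow> g \<in> L2 (horizon N) \<Longrightarrow>
      norm (Dobs f - Dobs g) \<le> K' * L2_norm (horizon N) (\<lambda>s. f s - g s)"
    using bounded_linear_map_diff_bound[OF Dobs L2_diff] L2_norm_nonneg by metis
  have "norm (Dobs (\<lambda>t. u n t - uo r t) - Dobs (\<lambda>t. v t - uo r t))
      \<le> K' * L2_norm (horizon N) (\<lambda>t. u n t - v t)" for n
    using K'[of "\<lambda>t. u n t - uo r t" "\<lambda>t. v t - uo r t"] u v uo r by (simp add: L2_diff)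
  moreover have "(\<lambda>n. K' * L2_norm (horizon N) (\<lambda>t. u n t - v t)) \<longlonglongrightarrow> 0"
    by (intro tendsto_mult_right_zero lim)
  ultimately show "(\<lambda>n. Dobs (\<lambda>t. u n t - uo r t)) \<longlonglongrightarrow> Dobs (\<lambda>t. v t - uo r t)"
    by (rule tendsto_of_diff_bound)
qed

section \<open>Compactness of the set of weights\<close>

lemma compact_std_simplex: "compact (std_simplex :: (real ^ 'm::finite) set)"
proof -
  have "closed (std_simplex :: (real ^ 'm) set)"
    unfolding std_simplex_def
    by (intro closed_Collect_conj closed_Collect_all closed_Collect_le closed_Collect_eq continuous_intros)
  moreover have "norm b \<le> 1" if "b \<in> std_simplex" for b :: "real ^ 'm"
  proof -
    have "norm b \<le> (\<Sum>l\<in>UNIV. \<bar>b $ l\<bar>)" by (rule norm_le_l1_cart)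
    also have "\<dots> = 1" using that by (simp add: std_simplex_def)
    finally show ?thesis .
  qed
  then have "bounded (std_simplex :: (real ^ 'm) set)"
    unfolding bounded_iff by blast
  ultimately show ?thesis by (simp add: compact_eq_bounded_closed)
qed

lemma std_simplex_nonempty: "std_simplex \<noteq> ({} :: (real ^ 'm::finite) set)"
proof -
  have "(\<chi> _. 1 / real CARD('m)) \<in> (std_simplex :: (real ^ 'm) set)"
    by (simp add: std_simplex_def)
  then show ?thesis by blast
qed

text \<open>Tychonoff on the full function type: extensionality pins every coordinate outside
  \<open>I\<close> to the singleton of \<open>undefined\<close>, which is compact too.\<close>

lemma compact_PiE:
  fixes S :: "'i \<Rightarrow> 'a::topological_space set"
  assumes "\<And>i. i \<in> I \<Longrightarrow> compact (S i)"
  shows "compact (Pi\<^sub>E I S)"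
proof -
  let ?S = "\<lambda>i. if i \<in> I then S i else {undefined}"
  have "compactin (product_topology (\<lambda>_. euclidean) UNIV) (Pi\<^sub>E UNIV ?S)"
    unfolding compactin_PiE using assms by (auto simp: compactin_euclidean_iff)
  moreover have "Pi\<^sub>E UNIV ?S = Pi\<^sub>E I S"
    by (auto simp: PiE_def Pi_def extensional_def split: if_splits)
  ultimately show ?thesis
    by (simp add: euclidean_product_topology compactin_euclidean_iff)
qed

theorem proposition2p9:
  fixes N :: network
    and D :: "nat \<Rightarrow> 'm::finite \<Rightarrow> real \<Rightarrow> real"
    and \<sigma> :: real
    and ua ub :: "real \<Rightarrow> ereal"
    and p :: nat
    and zo :: "nat \<Rightarrow> state"
    and uo :: "nat \<Rightarrow> real \<Rightarrow> real"
    and Cobs :: "state \<Rightarrow> 'hz::{real_inner, complete_space}"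
    and Dobs :: "(real \<Rightarrow> real) \<Rightarrow> 'hu::{real_inner, complete_space}"
  assumes "is_network N"
    and "2 \<le> CARD('m)"
    and "\<forall>i\<in>demand_vertices N. \<forall>l. D i l \<in> L2 (horizon N)"
    and "0 < \<sigma>"
    and "ua \<in> borel_measurable (lebesgue_on {0<..<horizon N})"
    and "ub \<in> borel_measurable (lebesgue_on {0<..<horizon N})"
    and "\<forall>t\<in>{0<..<horizon N}. ua t \<noteq> \<infinity>"
    and "\<forall>t\<in>{0<..<horizon N}. ub t \<noteq> -\<infinity>"
    and "admissible (horizon N) ua ub \<noteq> {}"
    and "\<forall>r\<in>{1..p}. zo r \<in> state_space N"
    and "\<forall>r\<in>{1..p}. uo r \<in> L2 (horizon N)"
    and "bounded_linear_map (state_space N) (state_norm N) Cobs"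
    and "bounded_linear_map (L2 (horizon N)) (L2_norm (horizon N)) Dobs"
  shows "\<exists>\<beta> u. is_arg_min (\<lambda>(\<beta>, u). bilevel_objective N p zo uo Cobs Dobs u)
                 (\<lambda>(\<beta>, u). (\<beta>, u) \<in> bilevel_feasible N D \<sigma> ua ub) (\<beta>, u)"
proof -
  obtain c d where "transport_network N c d"
    using transport_network_exists[OF assms(1)] .
  then interpret lower_level N c d D \<sigma> ua ub
    using assms(3,4,9) by (simp add: lower_level_def lower_level_axioms_def)
  let ?K = "demand_vertices N \<rightarrow>\<^sub>E (std_simplex :: (real ^ 'm) set)"
  let ?\<Psi> = "Psi N D \<sigma> ua ub"
  let ?F = "bilevel_objective N p zo uo Cobs Dobs"
  note F_continuous = bilevel_objective_continuous[OF assms(10-13)]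
  \<comment> \<open>Sequences suffice on a product over the countable index type, and convergence
    there is coordinatewise.\<close>
  have "continuous_on ?K (\<lambda>\<beta>. ?F (?\<Psi> \<beta>))"
    unfolding continuous_on_sequentially comp_def
  proof (intro allI ballI impI)
    fix b \<beta> assume b: "(\<forall>n. b n \<in> ?K) \<and> b \<longlonglongrightarrow> \<beta>"
    have "(\<lambda>n. b n i) \<longlonglongrightarrow> \<beta> i" for i
      using b continuous_on_tendsto_compose[OF continuous_on_product_coordinates, of b \<beta> sequentially i]
      by simp
    then show "(\<lambda>n. ?F (?\<Psi> (b n))) \<longlonglongrightarrow> ?F (?\<Psi> \<beta>)"
      by (intro F_continuous Psi_continuous Psi_L2)
  qed
  moreover have "compact ?K" "?K \<noteq> {}"
    using compact_std_simplex std_simplex_nonempty by (auto intro!: compact_PiE simp: PiE_eq_empty_iff)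
  ultimately obtain \<beta> where \<beta>: "\<beta> \<in> ?K" and min: "\<And>\<gamma>. \<gamma> \<in> ?K \<Longrightarrow> ?F (?\<Psi> \<beta>) \<le> ?F (?\<Psi> \<gamma>)"
    using continuous_attains_inf[of ?K "\<lambda>\<beta>. ?F (?\<Psi> \<beta>)"] by blast
  \<comment> \<open>A feasible control need only agree with \<open>Psi\<close> almost everywhere.
    Continuity along the constant sequence \<open>u\<close>, at distance zero from
    \<open>Psi\<close>, forces equal objective values.\<close>
  have F_cong: "?F u = ?F (?\<Psi> \<gamma>)"
    if "u \<in> L2 (horizon N)" "AE t in lebesgue_on {0<..<horizon N}. u t = ?\<Psi> \<gamma> t" for u \<gamma>
  proof -
    have "L2_norm (horizon N) (\<lambda>t. u t - ?\<Psi> \<gamma> t) = L2_norm (horizon N) (\<lambda>_. 0)"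
      using that by (intro L2_norm_cong_AE L2_diff L2_const Psi_L2) auto
    then have "(\<lambda>_::nat. L2_norm (horizon N) (\<lambda>t. u t - ?\<Psi> \<gamma> t)) \<longlonglongrightarrow> 0"
      by (simp add: L2_norm_def)
    then have "(\<lambda>_::nat. ?F u) \<longlonglongrightarrow> ?F (?\<Psi> \<gamma>)"
      using that(1) by (intro F_continuous Psi_L2)
    then show ?thesis by (simp add: LIMSEQ_const_iff)
  qed
  have "is_arg_min (\<lambda>(\<beta>, u). ?F u) (\<lambda>(\<beta>, u). (\<beta>, u) \<in> bilevel_feasible N D \<sigma> ua ub) (\<beta>, ?\<Psi> \<beta>)"
    using \<beta> min F_cong Psi_L2 unfolding is_arg_min_def bilevel_feasible_def by (auto simp: not_less)
  then show ?thesis by blast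
qed

end
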